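(* Let $X(t)$, $a\le t\le b$, be a Yeh process associated with functions $\lambda$ and $\rho$ on $[a,b]$, let $f\in L^2_{\lambda,\rho}[a,b]$, and let $M(t)=\int_a^t f(s)\,dX(s)$, $a\le t\le b$. With respect to the filtration $\mathcal F_t=\sigma\{X(s): a\le s\le t\}$, $a\le t\le b$, the following hold: (1) if $\lambda$ is increasing on $[a,b]$ and $f$ is nonpositive, then $M(t)$ is a supermartingale; (2) if $\lambda$ is decreasing on $[a,b]$ and $f$ is nonnegative, then $M(t)$ is a supermartingale; (3) if $\lambda$ is decreasing on $[a,b]$ and $f$ is nonpositive, then $M(t)$ is a submartingale.
   Context: Fix a finite interval $[a,b]\subset[0,\infty)$. Standing assumptions: $\lambda$ is a continuous real-valued function of bounded variation on $[a,b]$, with total variation function $|\lambda|$; $\rho$ is a continuous monotonically increasing real-valued function on $[a,b]$ whose Lebesgue-Stieltjes measure is equivalent (mutually absolutely continuous) to Lebesgue measure on $[a,b]$. A Yeh process associated with $\lambda,\rho$ is a real-valued stochastic process $X(t)$, $t\in[a,b]$, on a probability space $\Omega$, with (almost surely) continuous sample paths, which is additive, i.e. for all $a=t_0<t_1<\dots<t_n\le b$ the random variables $X(t_0),X(t_1)-X(t_0),\dots,X(t_n)-X(t_{n-1})$ are independent, and such that for all $a\le s<t\le b$, $X(t)-X(s)\sim N(\lambda(t)-\lambda(s),\rho(t)-\rho(s))$, where $N(\mu,\sigma^2)$ is the normal distribution with mean $\mu$ and variance $\sigma^2$. $L^2_{\lambda,\rho}[a,b]$ is the Hilbert space of real functions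 $f$ on $[a,b]$ with $\int_a^b|f|^2\,d\rho<\infty$ and $\int_a^b|f|^2\,d|\lambda|<\infty$, with inner product $\langle f,g\rangle_{\lambda,\rho}=\int_a^b fg\,d[\rho+|\lambda|]$. Wiener integral: for a step function $f=\sum_{i=1}^n c_i1_{[t_{i-1},t_i)}$ with $a=t_0<\dots<t_n=b$ and $c_i\in\mathbb R$, set $I(f)=\sum_{i=1}^n c_i(X(t_i)-X(t_{i-1}))$. Step functions are dense in $L^2_{\lambda,\rho}[a,b]$; for $f\in L^2_{\lambda,\rho}[a,b]$, $I(f)=\int_a^b f(t)\,dX(t)$ is defined as the $L^2(\Omega)$-limit of $I(f_n)$ for any sequence of step functions $f_n$ converging to $f$ in $L^2_{\lambda,\rho}[a,b]$ (the limit exists and does not depend on the sequence). For $a\le t\le b$, $\int_a^t f\,dX:=I(f1_{[a,t)})$. Wiener integrals are defined only up to almost sure equality, and adaptedness of $M$ is understood in that sense: $M(t)$ is almost surely equal to an $\mathcal F_t$-measurable random variable. Submartingale (supermartingale) means: adapted, $E|M(t)|<\infty$ for all $t$, and $E[M(t)\mid\mathcal F_s]\ge M(s)$ (respectively $\le M(s)$) almost surely for all $a\le s\le t\le b$. *)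

theory Defs
  imports "HOL-Probability.Probability"
begin

section \<open>Functions of bounded variation and Lebesgue--Stieltjes measures\<close>

definition is_partition :: "real \<Rightarrow> real \<Rightarrow> nat \<Rightarrow> (nat \<Rightarrow> real) \<Rightarrow> bool" where
  "is_partition a b n t \<longleftrightarrow> t 0 = a \<and> t n = b \<and> strict_mono_on {..n} t"

definition variation_sums :: "real \<Rightarrow> real \<Rightarrow> (real \<Rightarrow> real) \<Rightarrow> real set" where
  "variation_sums a b F = {(\<Sum>i = 1..n. \<bar>F (t i) - F (t (i - 1))\<bar>) | n t. is_partition a b n t}"

definition bounded_variation :: "real \<Rightarrow> real \<Rightarrow> (real \<Rightarrow> real) \<Rightarrow> bool" where
  "bounded_variation a b F \<longleftrightarrow> bdd_above (variation_sums a b F)"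

definition total_variation :: "real \<Rightarrow> (real \<Rightarrow> real) \<Rightarrow> real \<Rightarrow> real" where
  "total_variation a F x = Sup (variation_sums a x F)"

text \<open>\<^const>\<open>interval_measure\<close> wants a function on the whole line, so the function, which matters
  on \<open>{a..b}\<close> only, is continued by constants. It is applied below only to functions that are
  continuous and increasing on \<open>{a..b}\<close>; the result is complete, like \<^term>\<open>lebesgue_on {a..b}\<close>.\<close>

definition stieltjes_on :: "real \<Rightarrow> real \<Rightarrow> (real \<Rightarrow> real) \<Rightarrow> real measure" where
  "stieltjes_on a b F =
     restrict_space (completion (interval_measure (\<lambda>x. F (max a (min b x))))) {a..b}"

definition yeh_parameters :: "real \<Rightarrow> real \<Rightarrow> (real \<Rightarrow> real) \<Rightarrow> (real \<Rightarrow> real) \<Rightarrow> bool" where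
  "yeh_parameters a b lam \<rho> \<longleftrightarrow>
     continuous_on {a..b} lam \<and> bounded_variation a b lam \<and>
     continuous_on {a..b} \<rho> \<and> mono_on {a..b} \<rho> \<and>
     absolutely_continuous (lebesgue_on {a..b}) (stieltjes_on a b \<rho>) \<and>
     absolutely_continuous (stieltjes_on a b \<rho>) (lebesgue_on {a..b})"


section \<open>The space \<open>L\<^sup>2\<^sub>\<lambda>\<^sub>,\<^sub>\<rho>[a,b]\<close>\<close>

text \<open>Only the values of a function on \<open>{a..b}\<close> matter, and functions are not identified when they
  agree almost everywhere.\<close>

definition square_integrable :: "'x measure \<Rightarrow> ('x \<Rightarrow> real) \<Rightarrow> bool" where
  "square_integrable M f \<longleftrightarrow> f \<in> borel_measurable M \<and> integrable M (\<lambda>x. (f x)\<^sup>2)"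

definition L2_space :: "real \<Rightarrow> real \<Rightarrow> (real \<Rightarrow> real) \<Rightarrow> (real \<Rightarrow> real) \<Rightarrow> (real \<Rightarrow> real) set" where
  "L2_space a b lam \<rho> =
     {f. square_integrable (stieltjes_on a b \<rho>) f \<and>
         square_integrable (stieltjes_on a b (total_variation a lam)) f}"

definition L2_inner ::
  "real \<Rightarrow> real \<Rightarrow> (real \<Rightarrow> real) \<Rightarrow> (real \<Rightarrow> real) \<Rightarrow> (real \<Rightarrow> real) \<Rightarrow> (real \<Rightarrow> real) \<Rightarrow> real" where
  "L2_inner a b lam \<rho> f g =
     (\<integral>x. f x * g x \<partial>(stieltjes_on a b (\<lambda>x. \<rho> x + total_variation a lam x)))"

definition L2_norm ::
  "real \<Rightarrow> real \<Rightarrow> (real \<Rightarrow> real) \<Rightarrow> (real \<Rightarrow> real) \<Rightarrow> (real \<Rightarrow> real) \<Rightarrow> real" where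
  "L2_norm a b lam \<rho> f = sqrt (L2_inner a b lam \<rho> f f)"


section \<open>Yeh processes\<close>

text \<open>The variance \<open>\<rho> t - \<rho> s\<close> is positive for \<open>s < t\<close>, by \<^const>\<open>yeh_parameters\<close>; the second
  parameter of \<^const>\<open>normal_density\<close> is the standard deviation. The family of independent
  variables consists of \<open>X (t 0), X (t 1) - X (t 0), \<dots>, X (t n) - X (t (n - 1))\<close>, where
  \<open>t 0 = a\<close>.\<close>

definition yeh_process ::
  "real \<Rightarrow> real \<Rightarrow> (real \<Rightarrow> real) \<Rightarrow> (real \<Rightarrow> real) \<Rightarrow> 'w measure \<Rightarrow> (real \<Rightarrow> 'w \<Rightarrow> real) \<Rightarrow> bool" where
  "yeh_process a b lam \<rho> \<Omega> X \<longleftrightarrow>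
     prob_space \<Omega> \<and>
     (\<forall>t\<in>{a..b}. X t \<in> borel_measurable \<Omega>) \<and>
     (AE \<omega> in \<Omega>. continuous_on {a..b} (\<lambda>t. X t \<omega>)) \<and>
     (\<forall>n t u. is_partition a u n t \<and> u \<le> b \<longrightarrow>
        prob_space.indep_vars \<Omega> (\<lambda>_. borel)
          (\<lambda>i \<omega>. if i = 0 then X (t 0) \<omega> else X (t i) \<omega> - X (t (i - 1)) \<omega>) {..n}) \<and>
     (\<forall>s t. a \<le> s \<and> s < t \<and> t \<le> b \<longrightarrow>
        distributed \<Omega> lborel (\<lambda>\<omega>. X t \<omega> - X s \<omega>)
          (normal_density (lam t - lam s) (sqrt (\<rho> t - \<rho> s))))"


section \<open>The Wiener integral\<close>

definition step_fun :: "nat \<Rightarrow> (nat \<Rightarrow> real) \<Rightarrow> (nat \<Rightarrow> real) \<Rightarrow> real \<Rightarrow> real" where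
  "step_fun n t c x = (\<Sum>i = 1..n. c i * indicator {t (i - 1)..<t i} x)"

definition step_integral ::
  "(real \<Rightarrow> 'w \<Rightarrow> real) \<Rightarrow> nat \<Rightarrow> (nat \<Rightarrow> real) \<Rightarrow> (nat \<Rightarrow> real) \<Rightarrow> 'w \<Rightarrow> real" where
  "step_integral X n t c \<omega> = (\<Sum>i = 1..n. c i * (X (t i) \<omega> - X (t (i - 1)) \<omega>))"

text \<open>The random variable \<open>Y\<close> is a version of \<open>I(f)\<close>. The integral is determined up to almost sure
  equality only, hence a relation. As the \<open>L\<^sup>2(\<Omega>)\<close>-limit does not depend on the approximating
  sequence, it is enough to ask for one sequence of step functions.\<close>

definition has_wiener_integral ::
  "real \<Rightarrow> real \<Rightarrow> (real \<Rightarrow> real) \<Rightarrow> (real \<Rightarrow> real) \<Rightarrow> 'w measure \<Rightarrow> (real \<Rightarrow> 'w \<Rightarrow> real) \<Rightarrow>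
   (real \<Rightarrow> real) \<Rightarrow> ('w \<Rightarrow> real) \<Rightarrow> bool" where
  "has_wiener_integral a b lam \<rho> \<Omega> X f Y \<longleftrightarrow>
     f \<in> L2_space a b lam \<rho> \<and> square_integrable \<Omega> Y \<and>
     (\<exists>n t c. (\<forall>k. is_partition a b (n k) (t k)) \<and>
        (\<lambda>k. L2_norm a b lam \<rho> (\<lambda>x. step_fun (n k) (t k) (c k) x - f x)) \<longlonglongrightarrow> 0 \<and>
        (\<lambda>k. \<integral>\<omega>. (step_integral X (n k) (t k) (c k) \<omega> - Y \<omega>)\<^sup>2 \<partial>\<Omega>) \<longlonglongrightarrow> 0)"


section \<open>Natural filtration, submartingales and supermartingales\<close>

definition natural_filtration ::
  "real \<Rightarrow> 'w measure \<Rightarrow> (real \<Rightarrow> 'w \<Rightarrow> real) \<Rightarrow> real \<Rightarrow> 'w measure" where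
  "natural_filtration a \<Omega> X t =
     sigma (space \<Omega>) (\<Union>s\<in>{a..t}. {X s -` A \<inter> space \<Omega> | A. A \<in> sets borel})"

definition adapted_ae ::
  "real \<Rightarrow> real \<Rightarrow> 'w measure \<Rightarrow> (real \<Rightarrow> 'w measure) \<Rightarrow> (real \<Rightarrow> 'w \<Rightarrow> real) \<Rightarrow> bool" where
  "adapted_ae a b \<Omega> F M \<longleftrightarrow>
     (\<forall>t\<in>{a..b}. \<exists>N\<in>borel_measurable (F t). AE \<omega> in \<Omega>. M t \<omega> = N \<omega>)"

definition submartingale ::
  "real \<Rightarrow> real \<Rightarrow> 'w measure \<Rightarrow> (real \<Rightarrow> 'w measure) \<Rightarrow> (real \<Rightarrow> 'w \<Rightarrow> real) \<Rightarrow> bool" where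
  "submartingale a b \<Omega> F M \<longleftrightarrow>
     adapted_ae a b \<Omega> F M \<and> (\<forall>t\<in>{a..b}. integrable \<Omega> (M t)) \<and>
     (\<forall>s t. a \<le> s \<and> s \<le> t \<and> t \<le> b \<longrightarrow>
        (AE \<omega> in \<Omega>. real_cond_exp \<Omega> (F s) (M t) \<omega> \<ge> M s \<omega>))"

definition supermartingale ::
  "real \<Rightarrow> real \<Rightarrow> 'w measure \<Rightarrow> (real \<Rightarrow> 'w measure) \<Rightarrow> (real \<Rightarrow> 'w \<Rightarrow> real) \<Rightarrow> bool" where
  "supermartingale a b \<Omega> F M \<longleftrightarrow>
     adapted_ae a b \<Omega> F M \<and> (\<forall>t\<in>{a..b}. integrable \<Omega> (M t)) \<and>
     (\<forall>s t. a \<le> s \<and> s \<le> t \<and> t \<le> b \<longrightarrow>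
        (AE \<omega> in \<Omega>. real_cond_exp \<Omega> (F s) (M t) \<omega> \<le> M s \<omega>))"

end

theory Submission
  imports Defs
begin

text \<open>
  An integral \<open>M(t) = \<integral>\<^sub>a\<^sup>t f dX\<close> splits at an earlier time \<open>s\<close> into \<open>M(s)\<close> and an integral of
  increments of \<open>X\<close> after \<open>s\<close>. The latter is independent of the past and has mean
  \<open>\<integral>\<^sub>s\<^sup>t f d\<lambda>\<close>, hence \<open>E[M(t) | past of s] = M(s) + \<integral>\<^sub>s\<^sup>t f d\<lambda>\<close>, and the sign of the last
  integral, fixed by the sign of \<open>f\<close> and the direction of \<open>\<lambda>\<close>, decides between super- and
  submartingale.

  For step functions this is the independence of increments (\<open>past_indep_increment\<close>,
  \<open>elementary_truncate\<close>). The passage to \<open>L\<^sup>2\<close>-limits rests on the identity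
  \<open>E I(h)\<^sup>2 = \<integral> h\<^sup>2 d\<rho> + (\<integral> h d\<lambda>)\<^sup>2\<close> for step functions \<open>h\<close> (\<open>second_moment_elementary\<close>), which bounds
  the left side by a multiple of the squared norm of \<open>h\<close>. Thus the truncated approximations of
  \<open>f 1\<^bsub>[a,t)\<^esub>\<close> have integrals converging to \<open>M(s)\<close>; this gives both the adaptedness of \<open>M\<close>
  and the formula for the conditional expectation (\<open>wiener_integral_past\<close>,
  \<open>wiener_integral_cond_exp\<close>).

  In all three cases \<open>\<lambda>\<close> is monotone. Its total variation is then \<open>\<plusminus>(\<lambda> - \<lambda>(a))\<close>, and integrals
  against \<open>d\<lambda>\<close> are, up to sign, integrals against the measure of the total variation.
\<close>

section \<open>Stieltjes measures of continuous increasing functions\<close>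

abbreviation clamp :: "real \<Rightarrow> real \<Rightarrow> (real \<Rightarrow> real) \<Rightarrow> real \<Rightarrow> real" where
  "clamp a b F \<equiv> \<lambda>x. F (max a (min b x))"

lemma clamp_mono:
  assumes "a \<le> b" "mono_on {a..b} F" "x \<le> y"
  shows "clamp a b F x \<le> clamp a b F y"
  using assms by (intro mono_onD[OF assms(2)]) auto

lemma clamp_continuous:
  assumes "a \<le> b" "continuous_on {a..b} F"
  shows "continuous_on UNIV (clamp a b F)"
  by (rule continuous_on_compose2[OF assms(2)]) (use assms in \<open>auto intro!: continuous_on_max continuous_on_min\<close>)

lemma space_stieltjes_on [simp]: "space (stieltjes_on a b F) = {a..b}"
  by (simp add: stieltjes_on_def space_restrict_space)

lemma sets_stieltjes_on:
  "A \<in> sets (stieltjes_on a b F) \<longleftrightarrow>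
     A \<subseteq> {a..b} \<and> A \<in> sets (completion (interval_measure (clamp a b F)))"
  by (simp add: stieltjes_on_def sets_restrict_space_iff conj_commute)

lemma borel_sets_stieltjes_on:
  "A \<in> sets borel \<Longrightarrow> A \<subseteq> {a..b} \<Longrightarrow> A \<in> sets (stieltjes_on a b F)"
  by (simp add: sets_stieltjes_on)

lemma emeasure_stieltjes_on_Icc:
  assumes F: "continuous_on {a..b} F" "mono_on {a..b} F" and uv: "a \<le> u" "u \<le> v" "v \<le> b"
  shows "emeasure (stieltjes_on a b F) {u..v} = ennreal (F v - F u)"
proof -
  have ab: "a \<le> b" using uv by simp
  have "emeasure (stieltjes_on a b F) {u..v} = emeasure (interval_measure (clamp a b F)) {u..v}"
    unfolding stieltjes_on_def by (subst emeasure_restrict_space) (use uv in auto)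
  also have "\<dots> = ennreal (clamp a b F v - clamp a b F u)"
    by (rule emeasure_interval_measure_Icc[OF uv(2) clamp_mono[OF ab F(2)] clamp_continuous[OF ab F(1)]])
  finally show ?thesis using uv by (simp add: max_def min_def)
qed

lemma finite_measure_stieltjes_on:
  assumes "a \<le> b" "continuous_on {a..b} F" "mono_on {a..b} F"
  shows "finite_measure (stieltjes_on a b F)"
  by (rule finite_measureI) (simp add: emeasure_stieltjes_on_Icc assms)

lemma measure_stieltjes_on_Ico:
  assumes F: "continuous_on {a..b} F" "mono_on {a..b} F" and v: "a \<le> v" "v \<le> b"
  shows "measure (stieltjes_on a b F) {a..<v} = F v - F a"
proof -
  let ?M = "stieltjes_on a b F"
  interpret finite_measure ?M
    using assms by (intro finite_measure_stieltjes_on) auto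
  have le: "F a \<le> F v" using v by (intro mono_onD[OF F(2)]) auto
  have "{a..<v} = {a..v} - {v..v}" using v by auto
  moreover have "measure ?M ({a..v} - {v..v}) = measure ?M {a..v} - measure ?M {v..v}"
    by (rule finite_measure_Diff; (rule borel_sets_stieltjes_on)?) (use v in auto)
  ultimately have "measure ?M {a..<v} = measure ?M {a..v} - measure ?M {v..v}" by (rule ssubst)
  then show ?thesis
    using v le by (simp add: emeasure_stieltjes_on_Icc[OF F] measure_def del: atLeastAtMost_singleton)
qed

text \<open>The set function on the right is a measure that agrees with the one on the left on half-open
  intervals.\<close>

lemma emeasure_interval_measure_clamp_add:
  assumes ab: "a \<le> b" and F: "continuous_on {a..b} F" "mono_on {a..b} F"
    and G: "continuous_on {a..b} G" "mono_on {a..b} G" and A: "A \<in> sets borel"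
  shows "emeasure (interval_measure (clamp a b (\<lambda>x. F x + G x))) A =
    emeasure (interval_measure (clamp a b F)) A + emeasure (interval_measure (clamp a b G)) A"
proof -
  let ?MF = "interval_measure (clamp a b F)" and ?MG = "interval_measure (clamp a b G)"
  let ?K = "interval_measure (clamp a b (\<lambda>x. F x + G x))"
  let ?e = "\<lambda>A. emeasure ?MF A + emeasure ?MG A"
  define S where "S = measure_of UNIV (sets borel) ?e"
  have FG: "continuous_on {a..b} (\<lambda>x. F x + G x)" "mono_on {a..b} (\<lambda>x. F x + G x)"
    using F G by (auto intro!: continuous_on_add mono_onI add_mono intro: mono_onD)
  have S: "emeasure S A = ?e A" if "A \<in> sets borel" for A
    unfolding S_def
  proof (rule emeasure_measure_of_sigma)
    show "sigma_algebra UNIV (sets (borel :: real measure))"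
      using sets.sigma_algebra_axioms[of "borel :: real measure"] by simp
    show "positive (sets borel) ?e" by (simp add: positive_def)
    show "countably_additive (sets borel) ?e"
    proof (rule countably_additiveI)
      fix A :: "nat \<Rightarrow> real set" assume A: "range A \<subseteq> sets borel" "disjoint_family A"
      then have "(\<Sum>i. emeasure ?MF (A i)) = emeasure ?MF (\<Union>i. A i)"
          "(\<Sum>i. emeasure ?MG (A i)) = emeasure ?MG (\<Union>i. A i)"
        by (auto intro!: suminf_emeasure)
      then show "(\<Sum>i. ?e (A i)) = ?e (\<Union>i. A i)"
        using suminf_add[of "\<lambda>i. emeasure ?MF (A i)" "\<lambda>i. emeasure ?MG (A i)"] by simp
    qed
  qed (use that in auto)
  have Ioc: "emeasure (interval_measure (clamp a b H)) {x<..y} =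
      ennreal (if x \<le> y then clamp a b H y - clamp a b H x else 0)"
    if "continuous_on {a..b} H" "mono_on {a..b} H" for H x y
  proof (rule emeasure_interval_measure_Ioc_eq)
    show "clamp a b H x \<le> clamp a b H y" if "x \<le> y" for x y
      by (rule clamp_mono[OF ab \<open>mono_on {a..b} H\<close> that])
    show "continuous (at_right x) (clamp a b H)" for x
      using clamp_continuous[OF ab that(1)]
      by (meson UNIV_I continuous_on_eq_continuous_within continuous_within_subset subset_UNIV)
  qed
  have "?K = S"
  proof (rule measure_eqI_generator_eq)
    let ?E = "range (\<lambda>(a, b). {a <.. b::real})"
    show "Int_stable ?E" by (auto simp: Int_stable_def)
    show "?E \<subseteq> Pow UNIV" by simp
    show "sets ?K = sigma_sets UNIV ?E"
      by (simp add: borel_sigma_sets_Ioc)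
    show "sets S = sigma_sets UNIV ?E"
      unfolding S_def by (simp add: borel_sigma_sets_Ioc sigma_sets_sigma_sets_eq)
    show "range (\<lambda>n. {- real n<..real n}) \<subseteq> ?E" by auto
    show "(\<Union>n. {- real n<..real n}) = UNIV"
    proof (intro equalityI subsetI UNIV_I)
      fix x :: real
      obtain n where "\<bar>x\<bar> < real n" using reals_Archimedean2 by blast
      then show "x \<in> (\<Union>n. {- real n<..real n})" by (intro UN_I[of n]) auto
    qed
    show "emeasure ?K {- real n<..real n} \<noteq> \<infinity>" for n
      by (simp add: Ioc[OF FG])
    show "emeasure ?K X = emeasure S X" if XE: "X \<in> ?E" for X
    proof -
      obtain x y where X: "X = {x<..y}" using XE by auto
      have "ennreal (p + r - (q + s)) = ennreal (p - q) + ennreal (r - s)"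
        if "q \<le> p" "s \<le> r" for p q r s :: real
        using that by (subst ennreal_plus[symmetric]) (auto simp: algebra_simps)
      note this[intro]
      show ?thesis
        unfolding X S[OF greaterThanAtMost_borel] Ioc[OF FG] Ioc[OF F] Ioc[OF G]
        using clamp_mono[OF ab F(2), of x y] clamp_mono[OF ab G(2), of x y] by auto
    qed
  qed
  then show ?thesis using S[OF A] by simp
qed

lemma nn_integral_add_measure:
  assumes sets: "sets K = sets M" "sets K = sets N"
    and add: "\<And>A. A \<in> sets K \<Longrightarrow> emeasure K A = emeasure M A + emeasure N A"
    and f: "f \<in> borel_measurable K"
  shows "(\<integral>\<^sup>+x. f x \<partial>K) = (\<integral>\<^sup>+x. f x \<partial>M) + (\<integral>\<^sup>+x. f x \<partial>N)"
  using f
proof (induction rule: borel_measurable_induct)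
  case (cong f g)
  have "space K = space M" "space K = space N" using sets by (auto dest: sets_eq_imp_space_eq)
  then have eq: "(\<integral>\<^sup>+x. f x \<partial>K) = (\<integral>\<^sup>+x. g x \<partial>K)" "(\<integral>\<^sup>+x. f x \<partial>M) = (\<integral>\<^sup>+x. g x \<partial>M)"
     "(\<integral>\<^sup>+x. f x \<partial>N) = (\<integral>\<^sup>+x. g x \<partial>N)"
    using cong(3) by (auto intro!: nn_integral_cong)
  show ?case unfolding eq by (fact cong(4))
next
  case (set A)
  then show ?case using add sets by simp
next
  case (mult u c)
  then have "u \<in> borel_measurable M" "u \<in> borel_measurable N"
    using sets measurable_cong_sets by blast+
  with mult show ?case by (simp add: nn_integral_cmult distrib_left)
next
  case (add u v)
  then have "u \<in> borel_measurable M" "u \<in> borel_measurable N"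
     "v \<in> borel_measurable M" "v \<in> borel_measurable N"
    using sets measurable_cong_sets by blast+
  with add show ?case by (simp add: nn_integral_add ac_simps)
next
  case (seq U)
  have U: "U i \<in> borel_measurable M" "U i \<in> borel_measurable N" for i
    using sets measurable_cong_sets seq(1) by blast+
  have inc: "incseq (\<lambda>i. integral\<^sup>N L (U i))" for L
    using seq.hyps by (auto simp: incseq_def le_fun_def intro!: nn_integral_mono)
  have "(\<integral>\<^sup>+x. Sup (range U) x \<partial>K) = (SUP i. integral\<^sup>N K (U i))"
    using seq by (simp add: nn_integral_monotone_convergence_SUP image_comp)
  also have "\<dots> = (SUP i. integral\<^sup>N M (U i) + integral\<^sup>N N (U i))"
    using seq by simp
  also have "\<dots> = (SUP i. integral\<^sup>N M (U i)) + (SUP i. integral\<^sup>N N (U i))"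
    by (rule ennreal_SUP_add[OF inc inc])
  also have "\<dots> = (\<integral>\<^sup>+x. Sup (range U) x \<partial>M) + (\<integral>\<^sup>+x. Sup (range U) x \<partial>N)"
    using seq U by (simp add: nn_integral_monotone_convergence_SUP image_comp)
  finally show ?case by (simp add: image_comp)
qed

text \<open>The norm of \<open>L\<^sup>2\<^sub>\<lambda>\<^sub>,\<^sub>\<rho>[a,b]\<close> is an integral against the completion of the sum of two
  measures, while membership in the space speaks of the completion of each summand. Since the
  Bochner integral of a function that is not measurable is \<open>0\<close>, a small norm means something only
  once measurability has been carried over to the sum.\<close>

lemma measurable_stieltjes_on_add:
  fixes g :: "real \<Rightarrow> real"
  assumes ab: "a \<le> b" and F: "continuous_on {a..b} F" "mono_on {a..b} F"
    and G: "continuous_on {a..b} G" "mono_on {a..b} G"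
    and gF: "g \<in> borel_measurable (stieltjes_on a b F)"
    and gG: "g \<in> borel_measurable (stieltjes_on a b G)"
  shows "g \<in> borel_measurable (stieltjes_on a b (\<lambda>x. F x + G x))"
proof -
  let ?MF = "interval_measure (clamp a b F)" and ?MG = "interval_measure (clamp a b G)"
  let ?K = "interval_measure (clamp a b (\<lambda>x. F x + G x))"
  note add = emeasure_interval_measure_clamp_add[OF ab F G]
  have key: "A \<in> sets (completion ?K)"
    if A: "A \<in> sets (completion ?MF)" "A \<in> sets (completion ?MG)" for A
  proof -
    obtain S N N' where 1: "A = S \<union> N" "N \<subseteq> N'" "N' \<in> null_sets ?MF" "S \<in> sets ?MF"
      using A(1) by (rule sets_completionE)
    obtain T P P' where 2: "A = T \<union> P" "P \<subseteq> P'" "P' \<in> null_sets ?MG" "T \<in> sets ?MG"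
      using A(2) by (rule sets_completionE)
    have bor: "N' \<in> sets borel" "P' \<in> sets borel" using 1 2 by auto
    have "emeasure ?MF (N' \<inter> P') = 0" "emeasure ?MG (N' \<inter> P') = 0"
      using emeasure_mono[of "N' \<inter> P'" N' ?MF] emeasure_mono[of "N' \<inter> P'" P' ?MG] 1(3) 2(3) bor
      by auto
    then have "N' \<inter> P' \<in> null_sets ?K"
      using bor by (intro null_setsI) (simp_all add: add)
    \<comment> \<open>What both Borel approximations from inside miss lies in both exceptional sets.\<close>
    moreover have "A = (S \<union> T) \<union> (A - (S \<union> T))" "A - (S \<union> T) \<subseteq> N' \<inter> P'" using 1 2 by auto
    moreover have "S \<union> T \<in> sets ?K" using 1 2 by auto
    ultimately show ?thesis by (intro sets_completionI)
  qed
  show ?thesis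
  proof (rule measurableI)
    fix A :: "real set" assume "A \<in> sets borel"
    from measurable_sets[OF gF this] measurable_sets[OF gG this]
    have "g -` A \<inter> {a..b} \<in> sets (completion ?MF)" "g -` A \<inter> {a..b} \<in> sets (completion ?MG)"
      unfolding sets_stieltjes_on space_stieltjes_on by blast+
    then have "g -` A \<inter> {a..b} \<in> sets (completion ?K)" by (rule key)
    then show "g -` A \<inter> space (stieltjes_on a b (\<lambda>x. F x + G x)) \<in> sets (stieltjes_on a b (\<lambda>x. F x + G x))"
      unfolding sets_stieltjes_on space_stieltjes_on by blast
  qed simp
qed

text \<open>A null set of the sum is a null set of both summands, so replacing \<open>g\<close> by a Borel version
  reduces the claim to the measures before completion.\<close>

lemma nn_integral_stieltjes_on_add:
  fixes g :: "real \<Rightarrow> ennreal"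
  assumes ab: "a \<le> b" and F: "continuous_on {a..b} F" "mono_on {a..b} F"
    and G: "continuous_on {a..b} G" "mono_on {a..b} G"
    and g: "g \<in> borel_measurable (stieltjes_on a b (\<lambda>x. F x + G x))"
  shows "(\<integral>\<^sup>+x. g x \<partial>stieltjes_on a b (\<lambda>x. F x + G x)) =
    (\<integral>\<^sup>+x. g x \<partial>stieltjes_on a b F) + (\<integral>\<^sup>+x. g x \<partial>stieltjes_on a b G)"
proof -
  let ?MF = "interval_measure (clamp a b F)" and ?MG = "interval_measure (clamp a b G)"
  let ?K = "interval_measure (clamp a b (\<lambda>x. F x + G x))"
  note add = emeasure_interval_measure_clamp_add[OF ab F G]
  define h where "h = (\<lambda>x. g x * indicator {a..b} x)"
  have h: "h \<in> borel_measurable (completion ?K)"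
    using g unfolding stieltjes_on_def h_def
    by (subst (asm) borel_measurable_restrict_space_iff_ennreal) auto
  have on: "(\<integral>\<^sup>+x. g x \<partial>stieltjes_on a b H) = (\<integral>\<^sup>+x. h x \<partial>interval_measure (clamp a b H))" for H
    unfolding stieltjes_on_def h_def
    by (subst nn_integral_restrict_space) (auto simp: nn_integral_completion)
  obtain h' where h': "h' \<in> borel_measurable ?K" "AE x in ?K. h x = h' x"
    using completion_ex_borel_measurable[OF h] by auto
  obtain N where N: "N \<in> null_sets ?K" "{x. h x \<noteq> h' x} \<subseteq> N"
    using h'(2) by (auto elim!: AE_E simp: null_sets_def)
  have "N \<in> null_sets ?MF" "N \<in> null_sets ?MG"
    using N(1) by (auto simp: null_sets_def add)
  with N(2) have ae: "AE x in ?MF. h x = h' x" "AE x in ?MG. h x = h' x"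
    by (auto intro: AE_I')
  have "(\<integral>\<^sup>+x. h x \<partial>?K) = (\<integral>\<^sup>+x. h' x \<partial>?K)" by (rule nn_integral_cong_AE) (rule h')
  also have "\<dots> = (\<integral>\<^sup>+x. h' x \<partial>?MF) + (\<integral>\<^sup>+x. h' x \<partial>?MG)"
    by (rule nn_integral_add_measure) (use h' in \<open>simp_all add: add\<close>)
  also have "\<dots> = (\<integral>\<^sup>+x. h x \<partial>?MF) + (\<integral>\<^sup>+x. h x \<partial>?MG)"
    using nn_integral_cong_AE[OF ae(1)] nn_integral_cong_AE[OF ae(2)] by simp
  finally show ?thesis by (simp add: on)
qed

section \<open>Square-integrable functions\<close>

lemma square_integrable_mult:
  assumes "square_integrable M f" "square_integrable M g"
  shows "integrable M (\<lambda>x. f x * g x)"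
proof (rule Bochner_Integration.integrable_bound)
  show "integrable M (\<lambda>x. (f x)\<^sup>2 + (g x)\<^sup>2)" "(\<lambda>x. f x * g x) \<in> borel_measurable M"
    using assms by (auto simp: square_integrable_def)
  have "\<bar>u * v\<bar> \<le> u\<^sup>2 + v\<^sup>2" for u v :: real
    using sum_squares_bound[of "\<bar>u\<bar>" "\<bar>v\<bar>"] abs_ge_zero[of "u * v"]
    unfolding abs_mult power2_abs by linarith
  then show "AE x in M. norm (f x * g x) \<le> norm ((f x)\<^sup>2 + (g x)\<^sup>2)" by simp
qed

lemma square_integrable_zero: "square_integrable M (\<lambda>x. 0)"
  by (simp add: square_integrable_def)

lemma square_integrable_cmult:
  "square_integrable M f \<Longrightarrow> square_integrable M (\<lambda>x. c * f x)"
  by (auto simp: square_integrable_def power_mult_distrib)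

lemma square_integrable_add:
  assumes "square_integrable M f" "square_integrable M g"
  shows "square_integrable M (\<lambda>x. f x + g x)"
  using assms square_integrable_mult[OF assms]
  by (auto simp: square_integrable_def power2_sum mult.assoc)

lemma square_integrable_diff:
  assumes "square_integrable M f" "square_integrable M g"
  shows "square_integrable M (\<lambda>x. f x - g x)"
  using square_integrable_add[OF assms(1) square_integrable_cmult[OF assms(2), of "-1"]] by simp

lemma square_integrable_mult_indicator:
  assumes "square_integrable M f" "A \<in> sets M"
  shows "square_integrable M (\<lambda>x. f x * indicator A x)"
proof -
  have "(f x * indicator A x)\<^sup>2 = indicator A x *\<^sub>R (f x)\<^sup>2" for x
    by (simp add: indicator_def)
  then show ?thesis
    using assms integrable_mult_indicator[of A M "\<lambda>x. (f x)\<^sup>2"]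
    by (simp add: square_integrable_def borel_measurable_times)
qed

lemma integral_square_mult_indicator_le:
  assumes "square_integrable M f" "A \<in> sets M"
  shows "(\<integral>x. (f x * indicator A x)\<^sup>2 \<partial>M) \<le> (\<integral>x. (f x)\<^sup>2 \<partial>M)"
  using assms square_integrable_mult_indicator[OF assms]
  by (intro integral_mono) (auto simp: square_integrable_def indicator_def)

lemma integral_square_triangle:
  assumes "square_integrable M f" "square_integrable M g" "square_integrable M h"
  shows "(\<integral>x. (f x - h x)\<^sup>2 \<partial>M) \<le> 2 * (\<integral>x. (f x - g x)\<^sup>2 \<partial>M) + 2 * (\<integral>x. (g x - h x)\<^sup>2 \<partial>M)"
proof -
  have i: "integrable M (\<lambda>x. (f x - h x)\<^sup>2)" "integrable M (\<lambda>x. (f x - g x)\<^sup>2)" "integrable M (\<lambda>x. (g x - h x)\<^sup>2)"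
    using square_integrable_diff assms by (auto simp: square_integrable_def)
  have "(u - w)\<^sup>2 \<le> 2 * (u - v)\<^sup>2 + 2 * (v - w)\<^sup>2" for u v w :: real
  proof -
    have "2 * (u - v)\<^sup>2 + 2 * (v - w)\<^sup>2 - (u - w)\<^sup>2 = (u - 2 * v + w)\<^sup>2"
      by (simp add: power2_eq_square algebra_simps)
    then show ?thesis using zero_le_power2[of "u - 2 * v + w"] by linarith
  qed
  then have "(\<integral>x. (f x - h x)\<^sup>2 \<partial>M) \<le> (\<integral>x. 2 * (f x - g x)\<^sup>2 + 2 * (g x - h x)\<^sup>2 \<partial>M)"
    using i by (intro integral_mono) auto
  also have "\<dots> = 2 * (\<integral>x. (f x - g x)\<^sup>2 \<partial>M) + 2 * (\<integral>x. (g x - h x)\<^sup>2 \<partial>M)"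
    using i by simp
  finally show ?thesis .
qed

context finite_measure
begin

lemma integrable_of_square_integrable: "square_integrable M f \<Longrightarrow> integrable M f"
  using square_integrable_mult[of M f "\<lambda>_. 1"] by (simp add: square_integrable_def)

text \<open>The Cauchy--Schwarz inequality against the constant \<open>1\<close>, read off from the
  nonnegativity of the variance of \<open>f\<close>.\<close>

lemma integral_square_le:
  assumes "square_integrable M f"
  shows "(\<integral>x. f x \<partial>M)\<^sup>2 \<le> measure M (space M) * (\<integral>x. (f x)\<^sup>2 \<partial>M)"
proof -
  let ?V = "measure M (space M)" and ?m = "\<integral>x. f x \<partial>M" and ?q = "\<integral>x. (f x)\<^sup>2 \<partial>M"
  have i: "integrable M f" "integrable M (\<lambda>x. (f x)\<^sup>2)"
    using integrable_of_square_integrable[OF assms] assms by (simp_all add: square_integrable_def)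
  show ?thesis
  proof (cases "?V = 0")
    case True
    then have "emeasure M (space M) = 0" by (simp add: emeasure_eq_measure)
    then have "AE x in M. f x = 0" by (intro AE_I'[of "space M"]) (auto intro: null_setsI)
    then have "?m = 0" by (rule integral_eq_zero_AE)
    then show ?thesis using True by simp
  next
    case False
    then have V: "?V > 0" by (simp add: zero_less_measure_iff)
    have "0 \<le> (\<integral>x. (?V * f x - ?m)\<^sup>2 \<partial>M)" by simp
    also have "\<dots> = (\<integral>x. ?V\<^sup>2 * (f x)\<^sup>2 + (- (2 * ?V * ?m) * f x + ?m\<^sup>2) \<partial>M)"
      by (intro Bochner_Integration.integral_cong refl) (simp add: power2_eq_square algebra_simps)
    also have "\<dots> = ?V\<^sup>2 * ?q + (- (2 * ?V * ?m) * ?m + ?m\<^sup>2 * ?V)"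
      using i by simp
    also have "\<dots> = ?V * (?V * ?q - ?m\<^sup>2)"
      by (simp add: power2_eq_square algebra_simps)
    finally show ?thesis using V by (simp add: zero_le_mult_iff)
  qed
qed

lemma tendsto_integral_of_L2:
  assumes f: "\<And>k. square_integrable M (f k)" "square_integrable M g"
    and lim: "(\<lambda>k. \<integral>x. (f k x - g x)\<^sup>2 \<partial>M) \<longlonglongrightarrow> 0" and A: "A \<in> sets M"
  shows "(\<lambda>k. \<integral>x. f k x * indicator A x \<partial>M) \<longlonglongrightarrow> (\<integral>x. g x * indicator A x \<partial>M)"
proof -
  let ?V = "measure M (space M)"
  have s: "square_integrable M (\<lambda>x. f k x - g x)" for k
    using f by (rule square_integrable_diff)
  have "(\<lambda>k. ((\<integral>x. f k x * indicator A x \<partial>M) - (\<integral>x. g x * indicator A x \<partial>M))\<^sup>2) \<longlonglongrightarrow> 0"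
  proof (rule tendsto_sandwich[OF always_eventually always_eventually tendsto_const])
    show "(\<lambda>k. ?V * (\<integral>x. (f k x - g x)\<^sup>2 \<partial>M)) \<longlonglongrightarrow> 0"
      using tendsto_mult_left[OF lim, of ?V] by simp
    show "\<forall>k. ((\<integral>x. f k x * indicator A x \<partial>M) - (\<integral>x. g x * indicator A x \<partial>M))\<^sup>2
       \<le> ?V * (\<integral>x. (f k x - g x)\<^sup>2 \<partial>M)"
    proof
      fix k
      have "(\<integral>x. f k x * indicator A x \<partial>M) - (\<integral>x. g x * indicator A x \<partial>M) =
          (\<integral>x. (f k x - g x) * indicator A x \<partial>M)"
        using f[THEN square_integrable_mult_indicator[OF _ A], THEN integrable_of_square_integrable]
        by (subst Bochner_Integration.integral_diff[symmetric]) (auto simp: left_diff_distrib)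
      then have "((\<integral>x. f k x * indicator A x \<partial>M) - (\<integral>x. g x * indicator A x \<partial>M))\<^sup>2 \<le>
          ?V * (\<integral>x. ((f k x - g x) * indicator A x)\<^sup>2 \<partial>M)"
        using integral_square_le[OF square_integrable_mult_indicator[OF s A]] by simp
      also have "\<dots> \<le> ?V * (\<integral>x. (f k x - g x)\<^sup>2 \<partial>M)"
        by (intro mult_left_mono integral_square_mult_indicator_le[OF s A]) simp
      finally show "((\<integral>x. f k x * indicator A x \<partial>M) - (\<integral>x. g x * indicator A x \<partial>M))\<^sup>2
       \<le> ?V * (\<integral>x. (f k x - g x)\<^sup>2 \<partial>M)" .
    qed
  qed simp
  then have "(\<lambda>k. (\<integral>x. f k x * indicator A x \<partial>M) - (\<integral>x. g x * indicator A x \<partial>M)) \<longlonglongrightarrow> 0"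
    by (simp add: power_tendsto_0_iff)
  then show ?thesis by (rule Lim_null[THEN iffD2])
qed

text \<open>Passing to a subsequence turns the \<open>L\<^sup>2\<close>-limit into an almost sure limit of
  \<open>F\<close>-measurable functions.\<close>

lemma L2_limit_measurable_subalgebra:
  assumes sub: "subalgebra M F" and f: "\<And>k. f k \<in> borel_measurable F" "\<And>k. square_integrable M (f k)"
    and g: "square_integrable M g" and lim: "(\<lambda>k. \<integral>x. (f k x - g x)\<^sup>2 \<partial>M) \<longlonglongrightarrow> 0"
  shows "\<exists>h\<in>borel_measurable F. AE x in M. g x = h x"
proof -
  have d: "square_integrable M (\<lambda>x. f k x - g x)" for k
    using f(2) g by (rule square_integrable_diff)
  have abs: "square_integrable M (\<lambda>x. norm (f k x - g x))" for k
    using d[of k] by (auto simp: square_integrable_def)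
  have "(\<lambda>k. (\<integral>x. norm (f k x - g x) \<partial>M)\<^sup>2) \<longlonglongrightarrow> 0"
  proof (rule tendsto_sandwich[OF always_eventually always_eventually tendsto_const])
    show "\<forall>k. (\<integral>x. norm (f k x - g x) \<partial>M)\<^sup>2 \<le> measure M (space M) * (\<integral>x. (f k x - g x)\<^sup>2 \<partial>M)"
      using integral_square_le[OF abs] by simp
    show "(\<lambda>k. measure M (space M) * (\<integral>x. (f k x - g x)\<^sup>2 \<partial>M)) \<longlonglongrightarrow> 0"
      using tendsto_mult_left[OF lim, of "measure M (space M)"] by simp
  qed simp
  then have "(\<lambda>k. \<integral>x. norm (f k x - g x) \<partial>M) \<longlonglongrightarrow> 0"
    by (simp add: power_tendsto_0_iff)
  from tendsto_L1_AE_subseq[OF integrable_of_square_integrable[OF d] this]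
  obtain r :: "nat \<Rightarrow> nat" where r: "AE x in M. (\<lambda>n. f (r n) x - g x) \<longlonglongrightarrow> 0" by auto
  show ?thesis
  proof (intro bexI)
    show "(\<lambda>x. lim (\<lambda>n. f (r n) x)) \<in> borel_measurable F"
      using f(1) by (intro borel_measurable_lim_metric)
    show "AE x in M. g x = lim (\<lambda>n. f (r n) x)"
      using r
    proof eventually_elim
      case (elim x)
      then have "(\<lambda>n. f (r n) x) \<longlonglongrightarrow> g x" by (rule Lim_null[THEN iffD2])
      then show ?case by (simp add: limI)
    qed
  qed
qed

end

section \<open>Independence of the past and the future increments\<close>

text \<open>All increments of a monotone function have the same sign, so every variation sum
  telescopes to the same value.\<close>

lemma total_variation_monotone:
  assumes x: "a \<le> x" "x \<le> b" and eps: "\<bar>e\<bar> = 1" and mono: "mono_on {a..b} (\<lambda>x. e * lam x)"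
  shows "total_variation a lam x = e * (lam x - lam a)"
proof -
  have "variation_sums a x lam = {e * (lam x - lam a)}"
  proof -
    have sum: "(\<Sum>i = 1..n. \<bar>lam (t i) - lam (t (i - 1))\<bar>) = e * (lam x - lam a)"
      if p: "is_partition a x n t" for n t
    proof -
      have t: "t 0 = a" "t n = x" "strict_mono_on {..n} t" using p by (auto simp: is_partition_def)
      have le: "t i \<le> t j" if "i \<le> j" "j \<le> n" for i j
        using strict_mono_onD[OF t(3), of i j] that by (cases "i = j") auto
      have abs: "\<bar>lam (t i) - lam (t (i - 1))\<bar> = e * lam (t i) - e * lam (t (i - 1))"
        if i: "i \<in> {1..n}" for i
      proof -
        have "e * lam (t (i - 1)) \<le> e * lam (t i)"
          using le[of 0 "i - 1"] le[of 0 i] le[of "i - 1" i] le[of "i - 1" n] le[of i n] t x i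
          by (intro mono_onD[OF mono]) auto
        then have "\<bar>e * (lam (t i) - lam (t (i - 1)))\<bar> = e * lam (t i) - e * lam (t (i - 1))"
          by (simp add: right_diff_distrib)
        then show ?thesis using eps by (simp add: abs_mult)
      qed
      have "(\<Sum>i = 1..m. \<bar>lam (t i) - lam (t (i - 1))\<bar>) = e * lam (t m) - e * lam (t 0)" if "m \<le> n" for m
        using that
      proof (induction m)
        case (Suc m)
        then show ?case using abs[of "Suc m"] by simp
      qed simp
      then show ?thesis using t by (simp add: right_diff_distrib)
    qed
    moreover have "\<exists>n t. is_partition a x n t"
    proof (cases "a = x")
      case True
      then show ?thesis
        by (intro exI[of _ 0] exI[of _ "\<lambda>_. a"]) (auto simp: is_partition_def strict_mono_on_def)
    next
      case False
      then show ?thesis using x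
        by (intro exI[of _ 1] exI[of _ "\<lambda>i. if i = 0 then a else x"])
           (auto simp: is_partition_def strict_mono_on_def)
    qed
    ultimately show ?thesis unfolding variation_sums_def by (auto; metis)
  qed
  then show ?thesis by (simp add: total_variation_def)
qed

text \<open>The sign \<open>eps\<close> is \<open>1\<close> for increasing and \<open>-1\<close> for decreasing \<open>lam\<close>, so that the signed
  measure \<open>d lam\<close> is \<open>eps\<close> times the measure of the total variation.\<close>

locale monotone_yeh =
  fixes a b :: real and lam \<rho> :: "real \<Rightarrow> real" and \<Omega> :: "'w measure"
    and X :: "real \<Rightarrow> 'w \<Rightarrow> real" and eps :: real
  assumes ab: "a < b"
    and par: "yeh_parameters a b lam \<rho>"
    and yeh: "yeh_process a b lam \<rho> \<Omega> X"
    and eps: "\<bar>eps\<bar> = 1"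
    and mono: "mono_on {a..b} (\<lambda>x. eps * lam x)"

sublocale monotone_yeh \<subseteq> prob_space \<Omega>
  using yeh by (simp add: yeh_process_def)

context monotone_yeh
begin

abbreviation "past \<equiv> natural_filtration a \<Omega> X"
abbreviation "var \<equiv> total_variation a lam"
abbreviation "M\<rho> \<equiv> stieltjes_on a b \<rho>"
abbreviation "Mvar \<equiv> stieltjes_on a b var"

lemma eps_eps [simp]: "eps * eps = 1" "eps * (eps * x) = x"
  using eps by (auto simp: abs_if split: if_splits)

lemma rv [measurable]: "t \<in> {a..b} \<Longrightarrow> X t \<in> borel_measurable \<Omega>"
  using yeh by (simp add: yeh_process_def)

lemma cont_\<rho>: "continuous_on {a..b} \<rho>" and mono_\<rho>: "mono_on {a..b} \<rho>"
  using par by (auto simp: yeh_parameters_def)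

lemma var_eq: "x \<in> {a..b} \<Longrightarrow> var x = eps * (lam x - lam a)"
  using total_variation_monotone[OF _ _ eps mono] by auto

lemma cont_var: "continuous_on {a..b} var"
proof -
  have "continuous_on {a..b} (\<lambda>x. eps * (lam x - lam a))"
    using par by (auto simp: yeh_parameters_def intro!: continuous_intros)
  then show ?thesis by (subst continuous_on_cong[OF refl var_eq])
qed

lemma mono_var: "mono_on {a..b} var"
proof (rule mono_onI)
  fix x y assume xy: "x \<in> {a..b}" "y \<in> {a..b}" "x \<le> y"
  then have "eps * lam x \<le> eps * lam y" by (rule mono_onD[OF mono])
  then show "var x \<le> var y" using xy by (simp add: var_eq right_diff_distrib)
qed

text \<open>Here the equivalence of \<open>d\<rho>\<close> with Lebesgue measure enters: an interval on which \<open>\<rho>\<close> were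
  constant would be null for \<open>d\<rho>\<close> and hence for Lebesgue measure. It makes the variances of the
  increments positive.\<close>

lemma strict_\<rho>:
  assumes "a \<le> s" "s < t" "t \<le> b"
  shows "\<rho> s < \<rho> t"
proof -
  have "\<rho> s \<noteq> \<rho> t"
  proof
    assume "\<rho> s = \<rho> t"
    then have "{s..t} \<in> null_sets M\<rho>"
      using assms emeasure_stieltjes_on_Icc[OF cont_\<rho> mono_\<rho>, of s t]
      by (auto intro!: null_setsI borel_sets_stieltjes_on)
    then have "{s..t} \<in> null_sets (lebesgue_on {a..b})"
      using par by (auto simp: yeh_parameters_def absolutely_continuous_def)
    then have "emeasure (lebesgue_on {a..b}) {s..t} = 0" by auto
    then show False using assms by (simp add: emeasure_restrict_space)
  qed
  moreover have "\<rho> s \<le> \<rho> t" using assms by (intro mono_onD[OF mono_\<rho>]) auto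
  ultimately show ?thesis by simp
qed

lemma increment_normal:
  assumes "a \<le> s" "s < t" "t \<le> b"
  shows "distributed \<Omega> lborel (\<lambda>\<omega>. X t \<omega> - X s \<omega>) (normal_density (lam t - lam s) (sqrt (\<rho> t - \<rho> s)))"
  using yeh assms by (simp add: yeh_process_def)

lemma increment_moments:
  assumes "a \<le> s" "s \<le> t" "t \<le> b"
  shows "square_integrable \<Omega> (\<lambda>\<omega>. X t \<omega> - X s \<omega>)"
    and "expectation (\<lambda>\<omega>. X t \<omega> - X s \<omega>) = lam t - lam s"
    and "expectation (\<lambda>\<omega>. (X t \<omega> - X s \<omega>)\<^sup>2) = \<rho> t - \<rho> s + (lam t - lam s)\<^sup>2"
proof -
  let ?Y = "\<lambda>\<omega>. X t \<omega> - X s \<omega>" and ?m = "lam t - lam s" and ?v = "\<rho> t - \<rho> s"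
  have "square_integrable \<Omega> ?Y \<and> expectation ?Y = ?m \<and> expectation (\<lambda>\<omega>. (?Y \<omega>)\<^sup>2) = ?v + ?m\<^sup>2"
  proof (cases "s = t")
    case True
    then show ?thesis by (simp add: square_integrable_def)
  next
    case False
    with assms have st: "a \<le> s" "s < t" "t \<le> b" by auto
    have sd: "sqrt ?v > 0" using strict_\<rho>[OF st] by simp
    note D = increment_normal[OF st]
    have meas: "?Y \<in> borel_measurable \<Omega>" using st by (intro borel_measurable_diff rv) auto
    have E: "expectation ?Y = ?m" and V: "variance ?Y = ?v"
      using normal_distributed_expectation[OF sd D] normal_distributed_variance[OF sd D] sd by auto
    have i1: "integrable \<Omega> ?Y"
      using distributed_integrable[OF D, of "\<lambda>x. x"] integrable_normal_moment_nz_1[OF sd] by simp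
    have i2: "integrable \<Omega> (\<lambda>\<omega>. (?Y \<omega> - ?m)\<^sup>2)"
      using distributed_integrable[OF D, of "\<lambda>x. (x - ?m)\<^sup>2"] integrable_normal_moment[OF sd] by simp
    have "integrable \<Omega> (\<lambda>\<omega>. (?Y \<omega> - ?m)\<^sup>2 + (2 * ?m * ?Y \<omega> - ?m\<^sup>2))"
      by (intro Bochner_Integration.integrable_add[OF i2] Bochner_Integration.integrable_diff
          integrable_mult_right i1 integrable_const)
    moreover have "(?Y \<omega> - ?m)\<^sup>2 + (2 * ?m * ?Y \<omega> - ?m\<^sup>2) = (?Y \<omega>)\<^sup>2" for \<omega>
      by (simp add: power2_eq_square algebra_simps)
    ultimately have i3: "integrable \<Omega> (\<lambda>\<omega>. (?Y \<omega>)\<^sup>2)" by (simp only:)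
    show ?thesis
      using variance_eq[OF i1 i3] E V meas i3 by (auto simp: square_integrable_def)
  qed
  then show "square_integrable \<Omega> ?Y" "expectation ?Y = ?m" "expectation (\<lambda>\<omega>. (?Y \<omega>)\<^sup>2) = ?v + ?m\<^sup>2"
    by blast+
qed

lemma space_past [simp]: "space (past s) = space \<Omega>"
  by (simp add: natural_filtration_def space_measure_of_conv)

lemma sets_past:
  "sets (past s) = sigma_sets (space \<Omega>) (\<Union>u\<in>{a..s}. {X u -` A \<inter> space \<Omega> | A. A \<in> sets borel})"
  unfolding natural_filtration_def by (rule sets_measure_of) auto

lemma measurable_past: "u \<in> {a..s} \<Longrightarrow> X u \<in> borel_measurable (past s)"
  by (rule measurableI) (simp, unfold sets_past space_past, rule sigma_sets.Basic, blast)

lemma subalgebra_past: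
  assumes "s \<le> b"
  shows "subalgebra \<Omega> (past s)"
proof -
  have "sets (past s) \<subseteq> sets \<Omega>"
    unfolding sets_past by (rule sets.sigma_sets_subset) (use assms in \<open>auto intro!: measurable_sets[OF rv]\<close>)
  then show ?thesis by (simp add: subalgebra_def)
qed

text \<open>The partial sums of the independent variables attached to a partition through a finite set
  \<open>U\<close> of times recover the values of the process on \<open>U\<close>.\<close>

lemma prob_cylinder_increment:
  assumes st: "a \<le> s" "s < t" "t \<le> b" and U: "finite U" "U \<subseteq> {a..s}"
    and B: "\<And>u. u \<in> U \<Longrightarrow> B u \<in> sets borel" and C: "C \<in> sets borel"
  shows "prob ({\<omega>\<in>space \<Omega>. \<forall>u\<in>U. X u \<omega> \<in> B u} \<inter> ((\<lambda>\<omega>. X t \<omega> - X s \<omega>) -` C \<inter> space \<Omega>)) =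
    prob {\<omega>\<in>space \<Omega>. \<forall>u\<in>U. X u \<omega> \<in> B u} * prob ((\<lambda>\<omega>. X t \<omega> - X s \<omega>) -` C \<inter> space \<Omega>)"
proof -
  let ?V = "U \<union> {a, s}"
  define xs where "xs = sorted_list_of_set ?V"
  define n where "n = length xs - 1"
  define p where "p = (\<lambda>i. if i \<le> n then xs ! i else t)"
  have "finite ?V" using U by simp
  then have xs: "set xs = ?V" "sorted_wrt (<) xs"
    unfolding xs_def using strict_sorted_list_of_set[of ?V] by (simp_all only: set_sorted_list_of_set)
  have ne: "xs \<noteq> []" using xs by auto
  have len: "length xs = Suc n" using ne by (simp add: n_def)
  have less: "xs ! i < xs ! j" if "i < j" "j \<le> n" for i j
    using sorted_wrt_nth_less[OF xs(2)] that len by simp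
  have le: "xs ! i \<le> xs ! j" if "i \<le> j" "j \<le> n" for i j
    using less[of i j] that by (cases "i = j") auto
  have rng: "a \<le> xs ! i" "xs ! i \<le> s" if "i \<le> n" for i
    using nth_mem[of i xs] xs(1) U st len that by auto
  have idx: "\<exists>i\<le>n. xs ! i = u" if "u \<in> ?V" for u
    using that xs(1) len by (metis in_set_conv_nth less_Suc_eq_le)
  have p0: "p 0 = a"
  proof -
    obtain i where "i \<le> n" "xs ! i = a" using idx[of a] by auto
    then show ?thesis using le[of 0 i] rng[of 0] by (simp add: p_def)
  qed
  have pn: "p n = s"
  proof -
    obtain i where "i \<le> n" "xs ! i = s" using idx[of s] by auto
    then show ?thesis using le[of i n] rng[of n] by (simp add: p_def)
  qed
  have part: "is_partition a t (Suc n) p"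
    unfolding is_partition_def
  proof (intro conjI strict_mono_onI)
    show "p i < p j" if "i \<in> {..Suc n}" "j \<in> {..Suc n}" "i < j" for i j
      using that less[of i j] rng[of i] st by (auto simp: p_def)
  qed (auto simp: p0, simp add: p_def)
  define D where "D = (\<lambda>i \<omega>. if i = 0 then X (p 0) \<omega> else X (p i) \<omega> - X (p (i - 1)) \<omega>)"
  \<comment> \<open>The first \<open>n + 1\<close> variables carry the path on \<open>U\<close>, the last one is \<open>X t - X s\<close>.\<close>
  have ind: "indep_vars (\<lambda>_. borel) D {..Suc n}"
    using yeh part st unfolding yeh_process_def D_def by blast
  have iv: "indep_var (PiM {..n} (\<lambda>_. borel)) (\<lambda>\<omega>. restrict (\<lambda>i. D i \<omega>) {..n})
      (PiM {Suc n} (\<lambda>_. borel)) (\<lambda>\<omega>. restrict (\<lambda>i. D i \<omega>) {Suc n})"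
    by (rule indep_var_restrict[OF ind]) auto
  have sum: "(\<Sum>j\<le>i. D j \<omega>) = X (p i) \<omega>" for i \<omega>
    by (induction i) (auto simp: D_def)
  obtain k where k: "\<And>u. u \<in> U \<Longrightarrow> k u \<le> n \<and> xs ! k u = u"
    using idx by (metis UnI1)
  define S where "S = {y\<in>space (PiM {..n} (\<lambda>_. borel::real measure)). \<forall>u\<in>U. (\<Sum>j\<le>k u. y j) \<in> B u}"
  define T where "T = {y\<in>space (PiM {Suc n} (\<lambda>_. borel::real measure)). y (Suc n) \<in> C}"
  have "S \<in> sets (PiM {..n} (\<lambda>_. borel))"
    unfolding S_def
  proof (rule sets.sets_Collect_finite_All[OF _ U(1)])
    fix u assume u: "u \<in> U"
    have "(\<lambda>y. \<Sum>j\<le>k u. y j) \<in> borel_measurable (PiM {..n} (\<lambda>_. borel::real measure))"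
      using k[OF u] by (intro borel_measurable_sum measurable_component_singleton) auto
    from measurable_sets[OF this B[OF u]]
    show "{y \<in> space (PiM {..n} (\<lambda>_. borel)). (\<Sum>j\<le>k u. y j) \<in> B u} \<in> sets (PiM {..n} (\<lambda>_. borel))"
      by (simp add: vimage_def Int_def conj_commute)
  qed
  moreover have "T \<in> sets (PiM {Suc n} (\<lambda>_. borel))"
  proof -
    have "(\<lambda>y. y (Suc n)) \<in> borel_measurable (PiM {Suc n} (\<lambda>_. borel::real measure))"
      by (intro measurable_component_singleton) auto
    from measurable_sets[OF this C] show ?thesis
      by (simp add: T_def vimage_def Int_def conj_commute)
  qed
  ultimately have eq: "prob ((\<lambda>\<omega>. (restrict (\<lambda>i. D i \<omega>) {..n}, restrict (\<lambda>i. D i \<omega>) {Suc n})) -` (S \<times> T) \<inter> space \<Omega>) =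
     prob ((\<lambda>\<omega>. restrict (\<lambda>i. D i \<omega>) {..n}) -` S \<inter> space \<Omega>) * prob ((\<lambda>\<omega>. restrict (\<lambda>i. D i \<omega>) {Suc n}) -` T \<inter> space \<Omega>)"
    by (rule indep_varD[OF iv])
  have inS: "restrict (\<lambda>i. D i \<omega>) {..n} \<in> S \<longleftrightarrow> (\<forall>u\<in>U. X u \<omega> \<in> B u)" for \<omega>
  proof -
    have "(\<Sum>j\<le>k u. restrict (\<lambda>i. D i \<omega>) {..n} j) = X u \<omega>" if "u \<in> U" for u
    proof -
      have "(\<Sum>j\<le>k u. restrict (\<lambda>i. D i \<omega>) {..n} j) = (\<Sum>j\<le>k u. D j \<omega>)"
        using k[OF that] by (intro sum.cong) auto
      then show ?thesis using k[OF that] by (simp add: sum p_def)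
    qed
    then show ?thesis by (simp add: S_def space_PiM)
  qed
  have inT: "restrict (\<lambda>i. D i \<omega>) {Suc n} \<in> T \<longleftrightarrow> X t \<omega> - X s \<omega> \<in> C" for \<omega>
    by (simp add: T_def space_PiM D_def pn) (simp add: p_def)
  show ?thesis
    using eq by (simp add: vimage_def inS inT Int_def conj_ac)
qed

text \<open>The cylinder sets form an intersection-stable generator of the past, so independence extends
  from them to the whole \<open>\<sigma>\<close>-algebra.\<close>

lemma past_indep_increment:
  assumes st: "a \<le> s" "s < t" "t \<le> b"
  shows "indep_set (sets (past s))
    (sigma_sets (space \<Omega>) {(\<lambda>\<omega>. X t \<omega> - X s \<omega>) -` C \<inter> space \<Omega> | C. C \<in> sets borel})"
proof -
  let ?Y = "\<lambda>\<omega>. X t \<omega> - X s \<omega>"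
  let ?c = "\<lambda>U B. {\<omega>\<in>space \<Omega>. \<forall>u\<in>U. X u \<omega> \<in> B u}"
  define G where "G = {?c U B | U B. finite U \<and> U \<subseteq> {a..s} \<and> (\<forall>u\<in>U. B u \<in> sets borel)}"
  define H where "H = {?Y -` C \<inter> space \<Omega> | C. C \<in> sets borel}"
  have Y: "?Y \<in> borel_measurable \<Omega>" using st by (intro borel_measurable_diff rv) auto
  have "indep_set G H"
    unfolding indep_sets2_eq
  proof (intro conjI ballI)
    show "G \<subseteq> events"
    proof
      fix E assume "E \<in> G"
      then obtain U B where E: "E = ?c U B" "finite U" "U \<subseteq> {a..s}" "\<forall>u\<in>U. B u \<in> sets borel"
        by (auto simp: G_def)
      have "{\<omega> \<in> space \<Omega>. X u \<omega> \<in> B u} \<in> events" if "u \<in> U" for u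
      proof -
        have "X u \<in> borel_measurable \<Omega>" using that E(3) st by (intro rv) auto
        from measurable_sets[OF this, of "B u"] that E(4) show ?thesis
          by (simp add: vimage_def Int_def conj_commute)
      qed
      then show "E \<in> events" unfolding E(1) by (intro sets.sets_Collect_finite_All E(2))
    qed
    show "H \<subseteq> events" using measurable_sets[OF Y] by (auto simp: H_def)
    fix E E' assume "E \<in> G" "E' \<in> H"
    then show "prob (E \<inter> E') = prob E * prob E'"
      by (auto simp: G_def H_def intro!: prob_cylinder_increment[OF st])
  qed
  moreover have "Int_stable G"
  proof (rule Int_stableI)
    fix E E' assume "E \<in> G" "E' \<in> G"
    then obtain U B V C where E: "E = ?c U B" "finite U" "U \<subseteq> {a..s}" "\<forall>u\<in>U. B u \<in> sets borel"
      and E': "E' = ?c V C" "finite V" "V \<subseteq> {a..s}" "\<forall>u\<in>V. C u \<in> sets borel"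
      by (auto simp: G_def)
    let ?D = "\<lambda>u. (if u \<in> U then B u else UNIV) \<inter> (if u \<in> V then C u else UNIV)"
    have "E \<inter> E' = ?c (U \<union> V) ?D" unfolding E(1) E'(1) by auto
    moreover have "\<forall>u\<in>U \<union> V. ?D u \<in> sets borel" using E(4) E'(4) by auto
    moreover have "finite (U \<union> V)" "U \<union> V \<subseteq> {a..s}" using E(2,3) E'(2,3) by auto
    ultimately show "E \<inter> E' \<in> G"
      unfolding G_def by (intro CollectI exI[of _ "U \<union> V"] exI[of _ ?D] conjI)
  qed
  moreover have "Int_stable H"
  proof (rule Int_stableI)
    fix E E' assume "E \<in> H" "E' \<in> H"
    then obtain B C where "E = ?Y -` B \<inter> space \<Omega>" "E' = ?Y -` C \<inter> space \<Omega>" "B \<in> sets borel" "C \<in> sets borel"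
      by (auto simp: H_def)
    then have "E \<inter> E' = ?Y -` (B \<inter> C) \<inter> space \<Omega>" "B \<inter> C \<in> sets borel" by auto
    then show "E \<inter> E' \<in> H" unfolding H_def by blast
  qed
  ultimately have ind: "indep_set (sigma_sets (space \<Omega>) G) (sigma_sets (space \<Omega>) H)"
    by (rule indep_set_sigma_sets)
  have "sets (past s) \<subseteq> sigma_sets (space \<Omega>) G"
    unfolding sets_past
  proof (rule sigma_sets_mono, safe)
    fix u and A :: "real set" assume u: "u \<in> {a..s}" and A: "A \<in> sets borel"
    have "X u -` A \<inter> space \<Omega> = ?c {u} (\<lambda>_. A)" by auto
    moreover have "finite {u}" "{u} \<subseteq> {a..s}" "\<forall>v\<in>{u}. A \<in> sets borel" using u A by simp_all
    ultimately have "X u -` A \<inter> space \<Omega> \<in> G"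
      unfolding G_def by (intro CollectI exI[of _ "{u}"] exI[of _ "\<lambda>_. A"] conjI)
    then show "X u -` A \<inter> space \<Omega> \<in> sigma_sets (space \<Omega>) G" by (rule sigma_sets.Basic)
  qed
  with ind show ?thesis unfolding indep_sets2_eq H_def[symmetric] by blast
qed

lemma expectation_past_times_increment:
  assumes st: "a \<le> s" "s \<le> t" "t \<le> b" and Z: "Z \<in> borel_measurable (past s)" "integrable \<Omega> Z"
  shows "expectation (\<lambda>\<omega>. Z \<omega> * (X t \<omega> - X s \<omega>)) = expectation Z * (lam t - lam s)"
proof (cases "s = t")
  case False
  then have st': "a \<le> s" "s < t" "t \<le> b" using st by auto
  let ?Y = "\<lambda>\<omega>. X t \<omega> - X s \<omega>"
  have Y: "?Y \<in> borel_measurable \<Omega>" using st by (intro borel_measurable_diff rv) auto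
  have "sigma_sets (space \<Omega>) {Z -` A \<inter> space \<Omega> |A. A \<in> sets borel} \<subseteq> sets (past s)"
    using sets.sigma_sets_subset[of "{Z -` A \<inter> space \<Omega> |A. A \<in> sets borel}" "past s"]
      measurable_sets[OF Z(1)] by auto
  then have "indep_var borel Z borel ?Y"
    using past_indep_increment[OF st'] Y Z(2) unfolding indep_var_eq indep_sets2_eq
    by (auto dest: subsetD)
  from indep_var_lebesgue_integral[OF this Z(2)] show ?thesis
    using increment_moments(1,2)[OF st] integrable_of_square_integrable by simp
qed simp

section \<open>Elementary integrands and their integrals\<close>

text \<open>The relation \<open>elementary u h Z\<close> pairs a combination \<open>h\<close> of indicators of intervals \<open>[a, v)\<close>
  with \<open>v \<le> u\<close> with its integral \<open>Z\<close>. Unlike the representation by a partition, it is visibly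
  closed under linear combinations and under truncation at a time, so that no common refinements
  of partitions are needed. It is a relation because one \<open>h\<close> has several such representations.\<close>

inductive elementary :: "real \<Rightarrow> (real \<Rightarrow> real) \<Rightarrow> ('w \<Rightarrow> real) \<Rightarrow> bool" for u where
  elementary_zero: "elementary u (\<lambda>_. 0) (\<lambda>_. 0)"
| elementary_add_indicator:
    "elementary u h Z \<Longrightarrow> a \<le> v \<Longrightarrow> v \<le> u \<Longrightarrow>
     elementary u (\<lambda>x. h x + c * indicator {a..<v} x) (\<lambda>\<omega>. Z \<omega> + c * (X v \<omega> - X a \<omega>))"

lemma elementary_mono:
  assumes "elementary u h Z" "u \<le> w"
  shows "elementary w h Z"
  using assms(1)
proof induction
  case (elementary_add_indicator h Z v c)
  then show ?case using assms(2) by (intro elementary.elementary_add_indicator) auto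
qed (rule elementary_zero)

lemma elementary_add:
  assumes h: "elementary u h Z" and h': "elementary u h' Z'"
  shows "elementary u (\<lambda>x. h x + h' x) (\<lambda>\<omega>. Z \<omega> + Z' \<omega>)"
  using h'
proof induction
  case elementary_zero
  then show ?case using h by simp
next
  case (elementary_add_indicator h' Z' v c)
  from elementary.elementary_add_indicator[OF this(4,2,3), of c]
  show ?case by (simp add: add.assoc)
qed

lemma elementary_cmult:
  assumes h: "elementary u h Z"
  shows "elementary u (\<lambda>x. d * h x) (\<lambda>\<omega>. d * Z \<omega>)"
  using h
proof induction
  case elementary_zero
  then show ?case using elementary.elementary_zero by simp
next
  case (elementary_add_indicator h Z v c)
  from elementary.elementary_add_indicator[OF this(4,2,3), of "d * c"]
  show ?case by (simp add: distrib_left mult.assoc)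
qed

lemma elementary_diff:
  assumes h: "elementary u h Z" and h': "elementary u h' Z'"
  shows "elementary u (\<lambda>x. h x - h' x) (\<lambda>\<omega>. Z \<omega> - Z' \<omega>)"
  using elementary_add[OF h elementary_cmult[OF h', of "-1"]] by simp

lemma elementary_indicator:
  "a \<le> v \<Longrightarrow> v \<le> u \<Longrightarrow> elementary u (indicator {a..<v}) (\<lambda>\<omega>. X v \<omega> - X a \<omega>)"
  using elementary_add_indicator[OF elementary_zero, of v u 1] by simp

lemma elementary_step:
  assumes "is_partition a b n t"
  shows "elementary b (step_fun n t c) (step_integral X n t c)"
proof -
  have t: "t 0 = a" "t n = b" "strict_mono_on {..n} t" using assms by (auto simp: is_partition_def)
  have le: "t i \<le> t j" if "i \<le> j" "j \<le> n" for i j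
    using strict_mono_onD[OF t(3), of i j] that by (cases "i = j") auto
  have "elementary b (step_fun m t c) (step_integral X m t c)" if "m \<le> n" for m
    using that
  proof (induction m)
    case 0
    show ?case
      using elementary_zero unfolding step_fun_def[abs_def] step_integral_def[abs_def]
      by (simp del: atLeastAtMost_iff)
  next
    case (Suc m)
    have m: "a \<le> t m" "t m \<le> t (Suc m)" "a \<le> t (Suc m)" "t m \<le> b" "t (Suc m) \<le> b"
      using le[of 0 m] le[of m "Suc m"] le[of 0 "Suc m"] le[of m n] le[of "Suc m" n] t Suc.prems by auto
    have "elementary b (\<lambda>x. c (Suc m) * (indicator {a..<t (Suc m)} x - indicator {a..<t m} x))
       (\<lambda>\<omega>. c (Suc m) * ((X (t (Suc m)) \<omega> - X a \<omega>) - (X (t m) \<omega> - X a \<omega>)))"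
      by (intro elementary_cmult elementary_diff elementary_indicator m)
    from elementary_add[OF Suc.IH this] Suc.prems
    have "elementary b (\<lambda>x. step_fun m t c x + c (Suc m) * (indicator {a..<t (Suc m)} x - indicator {a..<t m} x))
       (\<lambda>\<omega>. step_integral X m t c \<omega> + c (Suc m) * (X (t (Suc m)) \<omega> - X (t m) \<omega>))" by simp
    moreover have "step_fun (Suc m) t c =
       (\<lambda>x. step_fun m t c x + c (Suc m) * (indicator {a..<t (Suc m)} x - indicator {a..<t m} x))"
      using m by (auto simp: step_fun_def fun_eq_iff indicator_def)
    moreover have "step_integral X (Suc m) t c =
       (\<lambda>\<omega>. step_integral X m t c \<omega> + c (Suc m) * (X (t (Suc m)) \<omega> - X (t m) \<omega>))"
      by (simp add: step_integral_def fun_eq_iff)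
    ultimately show ?case by simp
  qed
  then show ?thesis by blast
qed

lemma elementary_measurable_past:
  assumes "elementary s h Z"
  shows "Z \<in> borel_measurable (past s)"
  using assms
proof induction
  case (elementary_add_indicator h Z v c)
  then have "X v \<in> borel_measurable (past s)" "X a \<in> borel_measurable (past s)"
    by (auto intro!: measurable_past)
  with elementary_add_indicator.IH show ?case by simp
qed simp

lemma elementary_square_integrable:
  assumes "elementary b h Z"
  shows "square_integrable \<Omega> Z"
  using assms
proof induction
  case (elementary_add_indicator h Z v c)
  then show ?case
    by (intro square_integrable_add square_integrable_cmult increment_moments) auto
qed (rule square_integrable_zero)

lemma square_integrable_Ico:
  assumes "v \<le> b" "continuous_on {a..b} F" "mono_on {a..b} F"
  shows "square_integrable (stieltjes_on a b F) (indicator {a..<v})"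
proof -
  interpret F: finite_measure "stieltjes_on a b F"
    using ab assms by (intro finite_measure_stieltjes_on) auto
  have "{a..<v} \<in> sets (stieltjes_on a b F)" using assms by (intro borel_sets_stieltjes_on) auto
  moreover have "(indicator {a..<v} x :: real)\<^sup>2 = indicator {a..<v} x" for x by (simp add: indicator_def)
  ultimately show ?thesis
    using F.emeasure_finite by (simp add: square_integrable_def less_top[symmetric])
qed

lemma elementary_square_integrable_stieltjes:
  assumes "elementary b h Z" "continuous_on {a..b} F" "mono_on {a..b} F"
  shows "square_integrable (stieltjes_on a b F) h"
  using assms(1)
proof induction
  case (elementary_add_indicator h Z v c)
  then show ?case
    using assms by (intro square_integrable_add square_integrable_cmult square_integrable_Ico) auto
qed (rule square_integrable_zero)

lemmas elementary_L2 =
  elementary_square_integrable_stieltjes[OF _ cont_\<rho> mono_\<rho>]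
  elementary_square_integrable_stieltjes[OF _ cont_var mono_var]

sublocale \<rho>: finite_measure M\<rho>
  using ab by (intro finite_measure_stieltjes_on cont_\<rho> mono_\<rho>) simp

sublocale var: finite_measure Mvar
  using ab by (intro finite_measure_stieltjes_on cont_var mono_var) simp

text \<open>The integral of \<open>h\<close> with respect to the signed measure \<open>d lam\<close>.\<close>

definition drift :: "(real \<Rightarrow> real) \<Rightarrow> real" where
  "drift h = eps * (\<integral>x. h x \<partial>Mvar)"

lemma drift_add:
  assumes "square_integrable Mvar h" "square_integrable Mvar g"
  shows "drift (\<lambda>x. h x + c * g x) = drift h + c * drift g"
  using assms[THEN var.integrable_of_square_integrable]
  by (simp add: drift_def distrib_left)

lemma drift_indicator:
  assumes "a \<le> v" "v \<le> b"
  shows "drift (indicator {a..<v}) = lam v - lam a"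
proof -
  have "(\<integral>x. indicator {a..<v} x \<partial>Mvar) = measure Mvar {a..<v}"
    using assms by (simp add: borel_sets_stieltjes_on integral_indicator Int_absorb2 subset_eq)
  also have "\<dots> = eps * (lam v - lam a)"
    using measure_stieltjes_on_Ico[OF cont_var mono_var assms] assms ab by (simp add: var_eq)
  finally show ?thesis by (simp add: drift_def)
qed

lemma increment_second_moment:
  assumes "a \<le> u" "u \<le> v" "v \<le> b"
  shows "expectation (\<lambda>\<omega>. (X u \<omega> - X a \<omega>) * (X v \<omega> - X a \<omega>)) =
    \<rho> u - \<rho> a + (lam u - lam a) * (lam v - lam a)"
proof -
  let ?W = "\<lambda>\<omega>. X u \<omega> - X a \<omega>" and ?Y = "\<lambda>\<omega>. X v \<omega> - X u \<omega>"
  have W: "square_integrable \<Omega> ?W" "expectation ?W = lam u - lam a"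
    "expectation (\<lambda>\<omega>. (?W \<omega>)\<^sup>2) = \<rho> u - \<rho> a + (lam u - lam a)\<^sup>2"
    using increment_moments[of a u] assms by auto
  have Y: "square_integrable \<Omega> ?Y" using increment_moments[of u v] assms by auto
  have past: "?W \<in> borel_measurable (past u)"
    using assms by (intro borel_measurable_diff measurable_past) auto
  have "expectation (\<lambda>\<omega>. ?W \<omega> * (X v \<omega> - X a \<omega>)) = expectation (\<lambda>\<omega>. (?W \<omega>)\<^sup>2 + ?W \<omega> * ?Y \<omega>)"
    by (simp add: power2_eq_square algebra_simps)
  also have "\<dots> = expectation (\<lambda>\<omega>. (?W \<omega>)\<^sup>2) + expectation (\<lambda>\<omega>. ?W \<omega> * ?Y \<omega>)"
    by (intro Bochner_Integration.integral_add square_integrable_mult W Y)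
       (use W in \<open>simp add: square_integrable_def\<close>)
  also have "expectation (\<lambda>\<omega>. ?W \<omega> * ?Y \<omega>) = expectation ?W * (lam v - lam u)"
    using assms by (intro expectation_past_times_increment past integrable_of_square_integrable W)
  finally show ?thesis unfolding W by (simp add: power2_eq_square right_diff_distrib)
qed

lemma second_moment_indicator:
  assumes u: "a \<le> u" "u \<le> b" and v: "a \<le> v" "v \<le> b"
  shows "expectation (\<lambda>\<omega>. (X u \<omega> - X a \<omega>) * (X v \<omega> - X a \<omega>)) =
    (\<integral>x. indicator {a..<u} x * indicator {a..<v} x \<partial>M\<rho>) +
    drift (indicator {a..<u}) * drift (indicator {a..<v})"
proof -
  have "(\<integral>x. indicator {a..<u} x * indicator {a..<v} x \<partial>M\<rho>) = (\<integral>x. indicat_real {a..<min u v} x \<partial>M\<rho>)"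
    by (intro Bochner_Integration.integral_cong refl) (auto simp: indicator_def)
  also have "\<dots> = measure M\<rho> {a..<min u v}"
    using u v by (simp add: borel_sets_stieltjes_on integral_indicator Int_absorb2 subset_eq)
  also have "\<dots> = \<rho> (min u v) - \<rho> a"
    using u v by (intro measure_stieltjes_on_Ico[OF cont_\<rho> mono_\<rho>]) auto
  finally have *: "(\<integral>x. indicator {a..<u} x * indicator {a..<v} x \<partial>M\<rho>) = \<rho> (min u v) - \<rho> a" .
  show ?thesis
  proof (cases "u \<le> v")
    case True
    then show ?thesis
      using increment_second_moment[of u v] u v by (simp add: * drift_indicator)
  next
    case False
    then show ?thesis
      using increment_second_moment[of v u] u v by (simp add: * drift_indicator mult.commute)
  qed
qed

text \<open>Both sides are bilinear, so the identity reduces to the generators \<open>1\<^bsub>[a,u)\<^esub>\<close> and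
  \<open>1\<^bsub>[a,v)\<^esub>\<close>, where it is the covariance computation \<open>second_moment_indicator\<close>.\<close>

lemma second_moment_elementary:
  assumes h: "elementary b h Z" and h': "elementary b h' Z'"
  shows "expectation (\<lambda>\<omega>. Z \<omega> * Z' \<omega>) = (\<integral>x. h x * h' x \<partial>M\<rho>) + drift h * drift h'"
proof -
  have gen: "expectation (\<lambda>\<omega>. Z \<omega> * (X v \<omega> - X a \<omega>)) =
      (\<integral>x. h x * indicator {a..<v} x \<partial>M\<rho>) + drift h * drift (indicator {a..<v})"
    if v: "a \<le> v" "v \<le> b" for v
    using h
  proof induction
    case elementary_zero
    then show ?case by (simp add: drift_def)
  next
    case (elementary_add_indicator h Z u c)
    have u: "a \<le> u" "u \<le> b" by fact+
    let ?W = "\<lambda>v \<omega>. X v \<omega> - X a \<omega>" and ?i = "\<lambda>v. indicator {a..<v} :: real \<Rightarrow> real"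
    have W: "square_integrable \<Omega> (?W v)" "square_integrable \<Omega> (?W u)"
      using u v by (auto intro: increment_moments)
    have Z: "square_integrable \<Omega> Z" by (rule elementary_square_integrable) fact
    have i: "square_integrable M\<rho> (?i v)" "square_integrable M\<rho> (?i u)" "square_integrable M\<rho> h"
      "square_integrable Mvar h" "square_integrable Mvar (?i u)"
      using u v elementary_L2[OF elementary_add_indicator(1)]
      by (auto intro: square_integrable_Ico cont_\<rho> mono_\<rho> cont_var mono_var)
    have "expectation (\<lambda>\<omega>. (Z \<omega> + c * ?W u \<omega>) * ?W v \<omega>) =
        expectation (\<lambda>\<omega>. Z \<omega> * ?W v \<omega> + c * (?W u \<omega> * ?W v \<omega>))"
      by (simp only: distrib_right mult.assoc)
    also have "\<dots> = expectation (\<lambda>\<omega>. Z \<omega> * ?W v \<omega>) + c * expectation (\<lambda>\<omega>. ?W u \<omega> * ?W v \<omega>)"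
      using square_integrable_mult[OF Z W(1)] square_integrable_mult[OF W(2,1)]
      by (subst Bochner_Integration.integral_add) auto
    also have "\<dots> = ((\<integral>x. h x * ?i v x \<partial>M\<rho>) + c * (\<integral>x. ?i u x * ?i v x \<partial>M\<rho>)) +
        drift (\<lambda>x. h x + c * ?i u x) * drift (?i v)"
      unfolding elementary_add_indicator.IH second_moment_indicator[OF u v] drift_add[OF i(4,5)]
      by (simp add: algebra_simps)
    also have "(\<integral>x. h x * ?i v x \<partial>M\<rho>) + c * (\<integral>x. ?i u x * ?i v x \<partial>M\<rho>) =
        (\<integral>x. h x * ?i v x + c * (?i u x * ?i v x) \<partial>M\<rho>)"
      using square_integrable_mult[OF i(3,1)] square_integrable_mult[OF i(2,1)]
      by (subst Bochner_Integration.integral_add) auto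
    also have "\<dots> = (\<integral>x. (h x + c * ?i u x) * ?i v x \<partial>M\<rho>)"
      by (simp only: distrib_right mult.assoc)
    finally show ?case .
  qed
  have Z: "square_integrable \<Omega> Z" using h by (rule elementary_square_integrable)
  note hh = elementary_L2[OF h]
  show ?thesis
    using h'
  proof induction
    case elementary_zero
    then show ?case by (simp add: drift_def)
  next
    case (elementary_add_indicator h' Z' u c)
    let ?W = "\<lambda>v \<omega>. X v \<omega> - X a \<omega>" and ?i = "\<lambda>v. indicator {a..<v} :: real \<Rightarrow> real"
    have u: "a \<le> u" "u \<le> b" by fact+
    have W: "square_integrable \<Omega> (?W u)"
      using u by (auto intro: increment_moments)
    have Z': "square_integrable \<Omega> Z'" by (rule elementary_square_integrable) fact
    have i: "square_integrable M\<rho> (?i u)" "square_integrable M\<rho> h'"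
      "square_integrable Mvar h'" "square_integrable Mvar (?i u)"
      using u elementary_L2[OF elementary_add_indicator(1)]
      by (auto intro: square_integrable_Ico cont_\<rho> mono_\<rho> cont_var mono_var)
    have "expectation (\<lambda>\<omega>. Z \<omega> * (Z' \<omega> + c * ?W u \<omega>)) =
        expectation (\<lambda>\<omega>. Z \<omega> * Z' \<omega> + c * (Z \<omega> * ?W u \<omega>))"
      by (simp only: distrib_left mult.left_commute)
    also have "\<dots> = expectation (\<lambda>\<omega>. Z \<omega> * Z' \<omega>) + c * expectation (\<lambda>\<omega>. Z \<omega> * ?W u \<omega>)"
      using square_integrable_mult[OF Z Z'] square_integrable_mult[OF Z W]
      by (subst Bochner_Integration.integral_add) auto
    also have "\<dots> = ((\<integral>x. h x * h' x \<partial>M\<rho>) + c * (\<integral>x. h x * ?i u x \<partial>M\<rho>)) +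
        drift h * drift (\<lambda>x. h' x + c * ?i u x)"
      unfolding elementary_add_indicator.IH gen[OF u] drift_add[OF i(3,4)]
      by (simp add: algebra_simps)
    also have "(\<integral>x. h x * h' x \<partial>M\<rho>) + c * (\<integral>x. h x * ?i u x \<partial>M\<rho>) =
        (\<integral>x. h x * h' x + c * (h x * ?i u x) \<partial>M\<rho>)"
      using square_integrable_mult[OF hh(1) i(2)] square_integrable_mult[OF hh(1) i(1)]
      by (subst Bochner_Integration.integral_add) auto
    also have "\<dots> = (\<integral>x. h x * (h' x + c * ?i u x) \<partial>M\<rho>)"
      by (simp only: distrib_left mult.left_commute)
    finally show ?case .
  qed
qed

text \<open>The squared norm of \<open>L\<^sup>2\<^sub>\<lambda>\<^sub>,\<^sub>\<rho>[a,b]\<close>, written as a sum of integrals that can be estimated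
  separately.\<close>

definition sqnorm :: "(real \<Rightarrow> real) \<Rightarrow> real" where
  "sqnorm g = (\<integral>x. (g x)\<^sup>2 \<partial>M\<rho>) + (\<integral>x. (g x)\<^sup>2 \<partial>Mvar)"

lemma sqnorm_nonneg: "0 \<le> sqnorm g"
  by (simp add: sqnorm_def)

lemma L2_spaceD:
  assumes "g \<in> L2_space a b lam \<rho>"
  shows "square_integrable M\<rho> g" "square_integrable Mvar g"
  using assms by (simp_all add: L2_space_def)

lemma L2_norm_eq_sqnorm:
  assumes "g \<in> L2_space a b lam \<rho>"
  shows "(L2_norm a b lam \<rho> g)\<^sup>2 = sqnorm g"
proof -
  let ?K = "stieltjes_on a b (\<lambda>x. \<rho> x + var x)"
  note g = L2_spaceD[OF assms]
  have le: "a \<le> b" using ab by simp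
  have meas: "g \<in> borel_measurable ?K"
    using g by (intro measurable_stieltjes_on_add[OF le cont_\<rho> mono_\<rho> cont_var mono_var])
      (auto simp: square_integrable_def)
  have "(\<integral>\<^sup>+x. ennreal ((g x)\<^sup>2) \<partial>?K) = (\<integral>\<^sup>+x. ennreal ((g x)\<^sup>2) \<partial>M\<rho>) + (\<integral>\<^sup>+x. ennreal ((g x)\<^sup>2) \<partial>Mvar)"
    using meas by (intro nn_integral_stieltjes_on_add[OF le cont_\<rho> mono_\<rho> cont_var mono_var]) simp
  also have "\<dots> = ennreal (\<integral>x. (g x)\<^sup>2 \<partial>M\<rho>) + ennreal (\<integral>x. (g x)\<^sup>2 \<partial>Mvar)"
    using g by (simp add: nn_integral_eq_integral square_integrable_def)
  also have "\<dots> = ennreal (sqnorm g)" by (simp add: sqnorm_def)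
  finally have "(\<integral>x. (g x)\<^sup>2 \<partial>?K) = sqnorm g"
    using meas sqnorm_nonneg by (subst integral_eq_nn_integral) auto
  then show ?thesis
    using sqnorm_nonneg[of g] by (simp add: L2_norm_def L2_inner_def power2_eq_square)
qed

text \<open>This continuity estimate makes the \<open>L\<^sup>2\<close>-limit of the integrals depend only on the limit of the
  integrands, whichever approximating sequence was chosen.\<close>

lemma elementary_second_moment_le:
  assumes "elementary b h Z"
  shows "expectation (\<lambda>\<omega>. (Z \<omega>)\<^sup>2) \<le> (1 + measure Mvar {a..b}) * sqnorm h"
proof -
  let ?r = "\<integral>x. (h x)\<^sup>2 \<partial>M\<rho>" and ?v = "\<integral>x. (h x)\<^sup>2 \<partial>Mvar" and ?V = "measure Mvar {a..b}"
  have "expectation (\<lambda>\<omega>. (Z \<omega>)\<^sup>2) = ?r + (drift h)\<^sup>2"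
    using second_moment_elementary[OF assms assms] by (simp add: power2_eq_square)
  also have "(drift h)\<^sup>2 = (\<integral>x. h x \<partial>Mvar)\<^sup>2"
    by (simp add: drift_def power_mult_distrib) (simp add: power2_eq_square)
  also have "\<dots> \<le> ?V * ?v"
    using var.integral_square_le[OF elementary_L2(2)[OF assms]] by simp
  also have "?r + ?V * ?v \<le> (1 + ?V) * (?r + ?v)"
    by (simp add: algebra_simps)
  finally show ?thesis by (simp add: sqnorm_def)
qed

lemma wiener_integral_approximation:
  assumes "has_wiener_integral a b lam \<rho> \<Omega> X g Y"
  obtains h Z where "\<And>k. elementary b (h k) (Z k)"
    "(\<lambda>k. sqnorm (\<lambda>x. h k x - g x)) \<longlonglongrightarrow> 0" "(\<lambda>k. expectation (\<lambda>\<omega>. (Z k \<omega> - Y \<omega>)\<^sup>2)) \<longlonglongrightarrow> 0"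
proof -
  from assms obtain n t c where part: "\<And>k. is_partition a b (n k) (t k)"
    and h: "(\<lambda>k. L2_norm a b lam \<rho> (\<lambda>x. step_fun (n k) (t k) (c k) x - g x)) \<longlonglongrightarrow> 0"
    and Z: "(\<lambda>k. \<integral>\<omega>. (step_integral X (n k) (t k) (c k) \<omega> - Y \<omega>)\<^sup>2 \<partial>\<Omega>) \<longlonglongrightarrow> 0"
    and g: "g \<in> L2_space a b lam \<rho>"
    unfolding has_wiener_integral_def by auto
  have el: "elementary b (step_fun (n k) (t k) (c k)) (step_integral X (n k) (t k) (c k))" for k
    by (rule elementary_step[OF part])
  have "(\<lambda>x. step_fun (n k) (t k) (c k) x - g x) \<in> L2_space a b lam \<rho>" for k
    using elementary_L2[OF el, of k] L2_spaceD[OF g]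
    by (auto simp: L2_space_def intro: square_integrable_diff)
  from L2_norm_eq_sqnorm[OF this] tendsto_power[OF h, of 2]
  have "(\<lambda>k. sqnorm (\<lambda>x. step_fun (n k) (t k) (c k) x - g x)) \<longlonglongrightarrow> 0" by simp
  from that[OF el this Z] show thesis .
qed

text \<open>The integral of \<open>h\<close> splits at the time \<open>s\<close>. The part before \<open>s\<close> is measurable with respect to
  the past of \<open>s\<close>; the part after \<open>s\<close> consists of increments independent of it, so that only its
  mean survives on events of the past.\<close>

lemma elementary_truncate:
  assumes s: "a \<le> s" "s \<le> b" and h: "elementary b h Z"
  obtains Z' where "elementary s (\<lambda>x. h x * indicator {a..<s} x) Z'"
    "\<And>A. A \<in> sets (past s) \<Longrightarrow> expectation (\<lambda>\<omega>. (Z \<omega> - Z' \<omega>) * indicator A \<omega>) =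
       prob A * (drift h - drift (\<lambda>x. h x * indicator {a..<s} x))"
proof -
  have "\<exists>Z'. elementary s (\<lambda>x. h x * indicator {a..<s} x) Z' \<and>
    (\<forall>A\<in>sets (past s). expectation (\<lambda>\<omega>. (Z \<omega> - Z' \<omega>) * indicator A \<omega>) =
       prob A * (drift h - drift (\<lambda>x. h x * indicator {a..<s} x)))"
    using h
  proof induction
    case elementary_zero
    show ?case
      by (rule exI[of _ "\<lambda>_. 0"]) (use elementary.elementary_zero in \<open>simp add: drift_def\<close>)
  next
    case (elementary_add_indicator h Z v c)
    let ?h' = "\<lambda>x. h x * indicator {a..<s} x" and ?w = "min v s"
    have v: "a \<le> v" "v \<le> b" by fact+
    obtain Z' where Z': "elementary s ?h' Z'" and E: "\<And>A. A \<in> sets (past s) \<Longrightarrow>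
        expectation (\<lambda>\<omega>. (Z \<omega> - Z' \<omega>) * indicator A \<omega>) = prob A * (drift h - drift ?h')"
      using elementary_add_indicator.IH by auto
    have fn: "(\<lambda>x. (h x + c * indicator {a..<v} x) * indicator {a..<s} x) =
        (\<lambda>x. ?h' x + c * indicator {a..<?w} x)"
      by (auto simp: fun_eq_iff indicator_def)
    let ?Z = "\<lambda>\<omega>. Z' \<omega> + c * (X ?w \<omega> - X a \<omega>)"
    have el: "elementary s (\<lambda>x. ?h' x + c * indicator {a..<?w} x) ?Z"
      by (rule elementary.elementary_add_indicator[OF Z']) (use s v in auto)
    have Zs: "square_integrable \<Omega> Z" "square_integrable \<Omega> Z'"
      using elementary_square_integrable[OF elementary_add_indicator(1)]
        elementary_square_integrable[OF elementary_mono[OF Z' s(2)]] by auto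
    have hs: "square_integrable Mvar h" "square_integrable Mvar ?h'"
      using elementary_L2(2)[OF elementary_add_indicator(1)]
        elementary_L2(2)[OF elementary_mono[OF Z' s(2)]] by auto
    have ind: "square_integrable Mvar (indicator {a..<v})" "square_integrable Mvar (indicator {a..<?w})"
      using v by (auto intro!: square_integrable_Ico cont_var mono_var)
    have "expectation (\<lambda>\<omega>. (Z \<omega> + c * (X v \<omega> - X a \<omega>) - ?Z \<omega>) * indicator A \<omega>) =
       prob A * (drift (\<lambda>x. h x + c * indicator {a..<v} x) - drift (\<lambda>x. ?h' x + c * indicator {a..<?w} x))"
      if A: "A \<in> sets (past s)" for A
    proof -
      have A': "A \<in> events" using A subalgebra_past[OF s(2)] by (auto simp: subalgebra_def)
      have inc: "expectation (\<lambda>\<omega>. indicator A \<omega> * (X v \<omega> - X ?w \<omega>)) = prob A * (lam v - lam ?w)"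
      proof (cases "v \<le> s")
        case False
        have "expectation (\<lambda>\<omega>. indicator A \<omega> * (X v \<omega> - X s \<omega>)) = expectation (indicator A) * (lam v - lam s)"
          using A A' s v False
          by (intro expectation_past_times_increment) (auto simp: less_top[symmetric])
        then show ?thesis using False A' by simp
      qed simp
      have i: "integrable \<Omega> (\<lambda>\<omega>. (Z \<omega> - Z' \<omega>) * indicator A \<omega>)"
        by (intro integrable_of_square_integrable square_integrable_mult_indicator square_integrable_diff Zs A')
      have "square_integrable \<Omega> (\<lambda>\<omega>. (X v \<omega> - X ?w \<omega>) * indicator A \<omega>)"
        using s v by (intro square_integrable_mult_indicator increment_moments A') auto
      then have i2: "integrable \<Omega> (\<lambda>\<omega>. indicator A \<omega> * (X v \<omega> - X ?w \<omega>))"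
        using integrable_of_square_integrable by (simp add: mult.commute)
      have "expectation (\<lambda>\<omega>. (Z \<omega> + c * (X v \<omega> - X a \<omega>) - ?Z \<omega>) * indicator A \<omega>) =
         expectation (\<lambda>\<omega>. (Z \<omega> - Z' \<omega>) * indicator A \<omega> + c * (indicator A \<omega> * (X v \<omega> - X ?w \<omega>)))"
        by (intro Bochner_Integration.integral_cong refl) (simp add: algebra_simps)
      also have "\<dots> = prob A * (drift h - drift ?h') + c * (prob A * (lam v - lam ?w))"
        using i i2 by (simp add: E[OF A] inc)
      also have "\<dots> = prob A * (drift (\<lambda>x. h x + c * indicator {a..<v} x) - drift (\<lambda>x. ?h' x + c * indicator {a..<?w} x))"
        using s v unfolding drift_add[OF hs(1) ind(1)] drift_add[OF hs(2) ind(2)]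
        by (simp add: drift_indicator algebra_simps)
      finally show ?thesis .
    qed
    then show ?case unfolding fn using el by (intro exI[of _ ?Z]) blast
  qed
  then show thesis using that by blast
qed

section \<open>Conditional expectations of Wiener integrals\<close>

lemma sqnorm_diff_le:
  assumes "square_integrable M\<rho> f" "square_integrable M\<rho> g" "square_integrable M\<rho> h"
    "square_integrable Mvar f" "square_integrable Mvar g" "square_integrable Mvar h"
  shows "sqnorm (\<lambda>x. f x - h x) \<le> 2 * sqnorm (\<lambda>x. f x - g x) + 2 * sqnorm (\<lambda>x. g x - h x)"
  using integral_square_triangle[OF assms(1-3)] integral_square_triangle[OF assms(4-6)]
  by (simp add: sqnorm_def)

lemma sqnorm_mult_indicator_le:
  assumes "square_integrable M\<rho> g" "square_integrable Mvar g" "v \<le> b"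
  shows "sqnorm (\<lambda>x. g x * indicator {a..<v} x) \<le> sqnorm g"
  unfolding sqnorm_def
  by (intro add_mono integral_square_mult_indicator_le assms borel_sets_stieltjes_on) (use assms in auto)

lemma sqnorm_commute: "sqnorm (\<lambda>x. f x - g x) = sqnorm (\<lambda>x. g x - f x)"
  by (simp add: sqnorm_def power2_commute)

lemma tendsto_drift:
  assumes h: "\<And>k. square_integrable Mvar (h k)" "square_integrable Mvar g"
    and lim: "(\<lambda>k. sqnorm (\<lambda>x. h k x - g x)) \<longlonglongrightarrow> 0"
  shows "(\<lambda>k. drift (h k)) \<longlonglongrightarrow> drift g"
proof -
  have "(\<lambda>k. \<integral>x. (h k x - g x)\<^sup>2 \<partial>Mvar) \<longlonglongrightarrow> 0"
    by (rule tendsto_sandwich[OF always_eventually always_eventually tendsto_const lim])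
       (auto simp: sqnorm_def)
  from var.tendsto_integral_of_L2[OF h this sets.top]
  have "(\<lambda>k. \<integral>x. h k x * indicator (space Mvar) x \<partial>Mvar) \<longlonglongrightarrow> (\<integral>x. g x * indicator (space Mvar) x \<partial>Mvar)" .
  moreover have "(\<integral>x. f x * indicator (space Mvar) x \<partial>Mvar) = (\<integral>x. f x \<partial>Mvar)" for f :: "real \<Rightarrow> real"
    by (intro Bochner_Integration.integral_cong) auto
  ultimately show ?thesis unfolding drift_def by (simp only:) (rule tendsto_mult_left)
qed

text \<open>Truncating at \<open>s\<close> an approximation of \<open>f 1\<^bsub>[a,t)\<^esub>\<close> yields one of \<open>f 1\<^bsub>[a,s)\<^esub>\<close>, whose integrals
  belong to the past of \<open>s\<close>. By the continuity estimate these integrals converge to the given version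
  \<open>Y\<close>, although \<open>Y\<close> was defined through another sequence. Measurability and the identity of
  \<open>elementary_truncate\<close> then pass to the limit.\<close>

lemma wiener_integral_past:
  assumes st: "a \<le> s" "s \<le> t" "t \<le> b"
    and Ms: "has_wiener_integral a b lam \<rho> \<Omega> X (\<lambda>x. f x * indicator {a..<s} x) Y"
    and Mt: "has_wiener_integral a b lam \<rho> \<Omega> X (\<lambda>x. f x * indicator {a..<t} x) Y'"
  shows "\<exists>N\<in>borel_measurable (past s). AE \<omega> in \<Omega>. Y \<omega> = N \<omega>"
    and "\<And>A. A \<in> sets (past s) \<Longrightarrow>
      expectation (\<lambda>\<omega>. Y' \<omega> * indicator A \<omega>) - expectation (\<lambda>\<omega>. Y \<omega> * indicator A \<omega>) =
      prob A * (drift (\<lambda>x. f x * indicator {a..<t} x) - drift (\<lambda>x. f x * indicator {a..<s} x))"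
proof -
  let ?fs = "\<lambda>x. f x * indicator {a..<s} x" and ?ft = "\<lambda>x. f x * indicator {a..<t} x"
  have sb: "s \<le> b" using st by simp
  have Y: "square_integrable \<Omega> Y" "square_integrable \<Omega> Y'"
    and f: "?fs \<in> L2_space a b lam \<rho>" "?ft \<in> L2_space a b lam \<rho>"
    using Ms Mt by (auto simp: has_wiener_integral_def)
  note fs = L2_spaceD[OF f(1)] and ft = L2_spaceD[OF f(2)]
  obtain g U where gU: "\<And>k. elementary b (g k) (U k)"
    "(\<lambda>k. sqnorm (\<lambda>x. g k x - ?fs x)) \<longlonglongrightarrow> 0" "(\<lambda>k. expectation (\<lambda>\<omega>. (U k \<omega> - Y \<omega>)\<^sup>2)) \<longlonglongrightarrow> 0"
    by (rule wiener_integral_approximation[OF Ms]) (rule that)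
  obtain h Z where hZ: "\<And>k. elementary b (h k) (Z k)"
    "(\<lambda>k. sqnorm (\<lambda>x. h k x - ?ft x)) \<longlonglongrightarrow> 0" "(\<lambda>k. expectation (\<lambda>\<omega>. (Z k \<omega> - Y' \<omega>)\<^sup>2)) \<longlonglongrightarrow> 0"
    by (rule wiener_integral_approximation[OF Mt]) (rule that)
  let ?h' = "\<lambda>k x. h k x * indicator {a..<s} x"
  have "\<forall>k. \<exists>Z'. elementary s (?h' k) Z' \<and> (\<forall>A\<in>sets (past s).
     expectation (\<lambda>\<omega>. (Z k \<omega> - Z' \<omega>) * indicator A \<omega>) = prob A * (drift (h k) - drift (?h' k)))"
  proof
    show "\<exists>Z'. elementary s (?h' k) Z' \<and> (\<forall>A\<in>sets (past s).
       expectation (\<lambda>\<omega>. (Z k \<omega> - Z' \<omega>) * indicator A \<omega>) = prob A * (drift (h k) - drift (?h' k)))" for k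
      by (rule elementary_truncate[OF st(1) sb hZ(1)[of k]]) blast
  qed
  from choice[OF this] obtain Z' where Z': "\<And>k. elementary s (?h' k) (Z' k)"
    and E: "\<And>k A. A \<in> sets (past s) \<Longrightarrow>
      expectation (\<lambda>\<omega>. (Z k \<omega> - Z' k \<omega>) * indicator A \<omega>) = prob A * (drift (h k) - drift (?h' k))"
    by blast
  have Z'b: "elementary b (?h' k) (Z' k)" for k by (rule elementary_mono[OF Z' sb])
  note h2 = elementary_L2[OF hZ(1)] and h'2 = elementary_L2[OF Z'b] and g2 = elementary_L2[OF gU(1)]
  have trunc: "(\<lambda>k. sqnorm (\<lambda>x. ?h' k x - ?fs x)) \<longlonglongrightarrow> 0"
  proof (rule tendsto_sandwich[OF always_eventually always_eventually tendsto_const hZ(2)])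
    show "\<forall>k. sqnorm (\<lambda>x. ?h' k x - ?fs x) \<le> sqnorm (\<lambda>x. h k x - ?ft x)"
    proof
      fix k
      have "(\<lambda>x. ?h' k x - ?fs x) = (\<lambda>x. (h k x - ?ft x) * indicator {a..<s} x)"
        using st by (auto simp: fun_eq_iff indicator_def)
      then show "sqnorm (\<lambda>x. ?h' k x - ?fs x) \<le> sqnorm (\<lambda>x. h k x - ?ft x)"
        using sqnorm_mult_indicator_le[OF square_integrable_diff[OF h2(1) ft(1)] square_integrable_diff[OF h2(2) ft(2)] sb, of k]
        by simp
    qed
  qed (simp add: sqnorm_nonneg)
  let ?C = "1 + measure Mvar {a..b}"
  have U: "square_integrable \<Omega> (U k)" and Zk: "square_integrable \<Omega> (Z k)"
    and Z'k: "square_integrable \<Omega> (Z' k)" for k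
    using elementary_square_integrable gU(1) hZ(1) Z'b by blast+
  have limZ': "(\<lambda>k. expectation (\<lambda>\<omega>. (Z' k \<omega> - Y \<omega>)\<^sup>2)) \<longlonglongrightarrow> 0"
  proof (rule tendsto_sandwich[OF always_eventually always_eventually tendsto_const])
    let ?B = "\<lambda>k. 2 * (?C * (2 * sqnorm (\<lambda>x. ?h' k x - ?fs x) + 2 * sqnorm (\<lambda>x. g k x - ?fs x))) +
       2 * expectation (\<lambda>\<omega>. (U k \<omega> - Y \<omega>)\<^sup>2)"
    have "?B \<longlonglongrightarrow> 2 * (?C * (2 * 0 + 2 * 0)) + 2 * 0"
      by (intro tendsto_intros trunc gU)
    then show "?B \<longlonglongrightarrow> 0" by simp
    show "\<forall>k. expectation (\<lambda>\<omega>. (Z' k \<omega> - Y \<omega>)\<^sup>2) \<le> ?B k"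
    proof
      fix k
      have "expectation (\<lambda>\<omega>. (Z' k \<omega> - U k \<omega>)\<^sup>2) \<le> ?C * sqnorm (\<lambda>x. ?h' k x - g k x)"
        by (rule elementary_second_moment_le[OF elementary_diff[OF Z'b gU(1)]])
      also have "\<dots> \<le> ?C * (2 * sqnorm (\<lambda>x. ?h' k x - ?fs x) + 2 * sqnorm (\<lambda>x. g k x - ?fs x))"
        using sqnorm_diff_le[OF h'2(1) fs(1) g2(1) h'2(2) fs(2) g2(2), of k k] sqnorm_commute[of ?fs "g k"]
        by (intro mult_left_mono) auto
      finally show "expectation (\<lambda>\<omega>. (Z' k \<omega> - Y \<omega>)\<^sup>2) \<le> ?B k"
        using integral_square_triangle[OF Z'k U Y(1), of k k] by linarith
    qed
  qed simp
  show "\<exists>N\<in>borel_measurable (past s). AE \<omega> in \<Omega>. Y \<omega> = N \<omega>"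
    by (rule L2_limit_measurable_subalgebra[OF subalgebra_past[OF sb] elementary_measurable_past[OF Z'] Z'k Y(1) limZ'])
  fix A assume A: "A \<in> sets (past s)"
  have A': "A \<in> events" using A subalgebra_past[OF sb] by (auto simp: subalgebra_def)
  let ?l = "\<lambda>k. expectation (\<lambda>\<omega>. Z k \<omega> * indicator A \<omega>) - expectation (\<lambda>\<omega>. Z' k \<omega> * indicator A \<omega>)"
  have "?l \<longlonglongrightarrow> expectation (\<lambda>\<omega>. Y' \<omega> * indicator A \<omega>) - expectation (\<lambda>\<omega>. Y \<omega> * indicator A \<omega>)"
    by (intro tendsto_diff tendsto_integral_of_L2 Zk Z'k Y hZ(3) limZ' A')
  moreover have "?l = (\<lambda>k. prob A * (drift (h k) - drift (?h' k)))"
  proof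
    fix k
    have "?l k = expectation (\<lambda>\<omega>. Z k \<omega> * indicator A \<omega> - Z' k \<omega> * indicator A \<omega>)"
      by (intro Bochner_Integration.integral_diff[symmetric] integrable_of_square_integrable
          square_integrable_mult_indicator Zk Z'k A')
    then show "?l k = prob A * (drift (h k) - drift (?h' k))"
      using E[OF A, of k] by (simp add: left_diff_distrib)
  qed
  moreover have "(\<lambda>k. prob A * (drift (h k) - drift (?h' k))) \<longlonglongrightarrow> prob A * (drift ?ft - drift ?fs)"
    by (intro tendsto_mult_left tendsto_diff tendsto_drift h2 h'2 fs ft hZ(2) trunc)
  ultimately show "expectation (\<lambda>\<omega>. Y' \<omega> * indicator A \<omega>) - expectation (\<lambda>\<omega>. Y \<omega> * indicator A \<omega>) =
      prob A * (drift ?ft - drift ?fs)"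
    using LIMSEQ_unique by simp
qed

text \<open>Only almost every value of \<open>Y\<close> agrees with a function measurable in the past, so the
  characterisation of the conditional expectation is applied to such a version \<open>N\<close>.\<close>

lemma wiener_integral_cond_exp:
  assumes st: "a \<le> s" "s \<le> t" "t \<le> b"
    and Ms: "has_wiener_integral a b lam \<rho> \<Omega> X (\<lambda>x. f x * indicator {a..<s} x) Y"
    and Mt: "has_wiener_integral a b lam \<rho> \<Omega> X (\<lambda>x. f x * indicator {a..<t} x) Y'"
  shows "AE \<omega> in \<Omega>. real_cond_exp \<Omega> (past s) Y' \<omega> =
    Y \<omega> + (drift (\<lambda>x. f x * indicator {a..<t} x) - drift (\<lambda>x. f x * indicator {a..<s} x))"
proof -
  let ?d = "drift (\<lambda>x. f x * indicator {a..<t} x) - drift (\<lambda>x. f x * indicator {a..<s} x)"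
  have sb: "s \<le> b" using st by simp
  interpret P: finite_measure_subalgebra \<Omega> "past s"
    by unfold_locales (rule subalgebra_past[OF sb])
  obtain N where N: "N \<in> borel_measurable (past s)" "AE \<omega> in \<Omega>. Y \<omega> = N \<omega>"
    using wiener_integral_past(1)[OF assms] by auto
  have Y: "square_integrable \<Omega> Y" "square_integrable \<Omega> Y'"
    using Ms Mt by (auto simp: has_wiener_integral_def)
  then have iY: "integrable \<Omega> Y" "integrable \<Omega> Y'" by (simp_all add: integrable_of_square_integrable)
  have N\<Omega>: "N \<in> borel_measurable \<Omega>"
    using N(1) measurable_from_subalg[OF subalgebra_past[OF sb]] by blast
  have iN: "integrable \<Omega> N"
    using iY(1) N N\<Omega> by (subst integrable_cong_AE[symmetric, of Y]) auto
  have "AE \<omega> in \<Omega>. real_cond_exp \<Omega> (past s) Y' \<omega> = N \<omega> + ?d"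
  proof (rule P.real_cond_exp_charact)
    fix A assume A: "A \<in> sets (past s)"
    have A': "A \<in> events" using A subalgebra_past[OF sb] by (auto simp: subalgebra_def)
    have int: "integrable \<Omega> (\<lambda>\<omega>. N \<omega> * indicator A \<omega>)"
      using integrable_mult_indicator[OF A' iN] by (simp add: mult.commute)
    have "(\<integral>\<omega>\<in>A. N \<omega> + ?d \<partial>\<Omega>) = (\<integral>\<omega>. N \<omega> * indicator A \<omega> + ?d * indicator A \<omega> \<partial>\<Omega>)"
      unfolding set_lebesgue_integral_def
      by (intro Bochner_Integration.integral_cong refl) (simp add: algebra_simps)
    also have "\<dots> = expectation (\<lambda>\<omega>. N \<omega> * indicator A \<omega>) + ?d * prob A"
      using int A' by (subst Bochner_Integration.integral_add) (auto simp: less_top[symmetric])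
    also have "expectation (\<lambda>\<omega>. N \<omega> * indicator A \<omega>) = expectation (\<lambda>\<omega>. Y \<omega> * indicator A \<omega>)"
      using N A' N\<Omega> iY(1) by (intro integral_cong_AE) auto
    also have "\<dots> + ?d * prob A = expectation (\<lambda>\<omega>. Y' \<omega> * indicator A \<omega>)"
      using wiener_integral_past(2)[OF assms A] by (simp add: mult.commute)
    finally show "(\<integral>\<omega>\<in>A. Y' \<omega> \<partial>\<Omega>) = (\<integral>\<omega>\<in>A. N \<omega> + ?d \<partial>\<Omega>)"
      by (simp add: set_lebesgue_integral_def mult.commute)
  qed (use iY iN N in auto)
  with N(2) show ?thesis by eventually_elim simp
qed

text \<open>The difference of the drifts is the integral of \<open>f\<close> over \<open>[s, t)\<close> against \<open>d lam\<close>. The factor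
  \<open>c = 1\<close> serves supermartingales and \<open>c = -1\<close> submartingales.\<close>

lemma drift_increment_sign:
  assumes st: "a \<le> s" "s \<le> t" "t \<le> b"
    and L2: "(\<lambda>x. f x * indicator {a..<s} x) \<in> L2_space a b lam \<rho>"
      "(\<lambda>x. f x * indicator {a..<t} x) \<in> L2_space a b lam \<rho>"
    and sgn: "\<And>x. x \<in> {a..b} \<Longrightarrow> c * eps * f x \<le> 0"
  shows "c * (drift (\<lambda>x. f x * indicator {a..<t} x) - drift (\<lambda>x. f x * indicator {a..<s} x)) \<le> 0"
proof -
  let ?fs = "\<lambda>x. f x * indicator {a..<s} x" and ?ft = "\<lambda>x. f x * indicator {a..<t} x"
  have i: "integrable Mvar ?ft" "integrable Mvar ?fs"
    using L2 by (auto intro: var.integrable_of_square_integrable L2_spaceD)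
  have "c * (drift ?ft - drift ?fs) = (\<integral>x. c * eps * (?ft x - ?fs x) \<partial>Mvar)"
    using i by (simp add: drift_def algebra_simps)
  also have "\<dots> = - (\<integral>x. - (c * eps * (?ft x - ?fs x)) \<partial>Mvar)"
    by simp
  also have "\<dots> \<le> 0"
  proof -
    have "0 \<le> (\<integral>x. - (c * eps * (?ft x - ?fs x)) \<partial>Mvar)"
    proof (rule Bochner_Integration.integral_nonneg)
      fix x assume "x \<in> space Mvar"
      then have "c * eps * f x \<le> 0" by (intro sgn) simp
      moreover have "?ft x - ?fs x = f x \<or> ?ft x - ?fs x = 0"
        using st by (auto simp: indicator_def)
      ultimately show "0 \<le> - (c * eps * (?ft x - ?fs x))" by auto
    qed
    then show ?thesis by linarith
  qed
  finally show ?thesis .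
qed

lemma wiener_integral_super_submartingale:
  assumes M: "\<And>t. t \<in> {a..b} \<Longrightarrow>
      has_wiener_integral a b lam \<rho> \<Omega> X (\<lambda>s. f s * indicator {a..<t} s) (M t)"
  shows "(\<And>x. x \<in> {a..b} \<Longrightarrow> eps * f x \<le> 0) \<Longrightarrow> supermartingale a b \<Omega> past M"
    and "(\<And>x. x \<in> {a..b} \<Longrightarrow> 0 \<le> eps * f x) \<Longrightarrow> submartingale a b \<Omega> past M"
proof -
  have L2: "(\<lambda>x. f x * indicator {a..<t} x) \<in> L2_space a b lam \<rho>" if "t \<in> {a..b}" for t
    using M[OF that] by (simp add: has_wiener_integral_def)
  have adapted: "adapted_ae a b \<Omega> past M"
    using wiener_integral_past(1)[OF _ order_refl _ M M] by (auto simp: adapted_ae_def)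
  have int: "\<forall>t\<in>{a..b}. integrable \<Omega> (M t)"
    using M by (auto simp: has_wiener_integral_def intro: integrable_of_square_integrable)
  let ?d = "\<lambda>s t. drift (\<lambda>x. f x * indicator {a..<t} x) - drift (\<lambda>x. f x * indicator {a..<s} x)"
  have ce: "AE \<omega> in \<Omega>. real_cond_exp \<Omega> (past s) (M t) \<omega> = M s \<omega> + ?d s t"
    if "a \<le> s" "s \<le> t" "t \<le> b" for s t
    using that by (intro wiener_integral_cond_exp M) auto
  show "supermartingale a b \<Omega> past M" if sgn: "\<And>x. x \<in> {a..b} \<Longrightarrow> eps * f x \<le> 0"
    unfolding supermartingale_def
  proof (intro conjI adapted int allI impI)
    fix s t assume st: "a \<le> s \<and> s \<le> t \<and> t \<le> b"
    have "1 * ?d s t \<le> 0"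
      using st sgn by (intro drift_increment_sign L2) auto
    then show "AE \<omega> in \<Omega>. real_cond_exp \<Omega> (past s) (M t) \<omega> \<le> M s \<omega>"
      using ce[of s t] st by auto
  qed
  show "submartingale a b \<Omega> past M" if sgn: "\<And>x. x \<in> {a..b} \<Longrightarrow> 0 \<le> eps * f x"
    unfolding submartingale_def
  proof (intro conjI adapted int allI impI)
    fix s t assume st: "a \<le> s \<and> s \<le> t \<and> t \<le> b"
    have "-1 * ?d s t \<le> 0"
      using st sgn by (intro drift_increment_sign L2) auto
    then show "AE \<omega> in \<Omega>. M s \<omega> \<le> real_cond_exp \<Omega> (past s) (M t) \<omega>"
      using ce[of s t] st by auto
  qed
qed

end

section \<open>The three cases\<close>

theorem mainTheorem4:
  fixes a b :: real
    and lam \<rho> f :: "real \<Rightarrow> real"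
    and \<Omega> :: "'w measure"
    and X M :: "real \<Rightarrow> 'w \<Rightarrow> real"
  assumes "0 \<le> a" and "a < b"
    and "yeh_parameters a b lam \<rho>"
    and "yeh_process a b lam \<rho> \<Omega> X"
    and "f \<in> L2_space a b lam \<rho>"
    and "\<And>t. t \<in> {a..b} \<Longrightarrow>
           has_wiener_integral a b lam \<rho> \<Omega> X (\<lambda>s. f s * indicator {a..<t} s) (M t)"
  shows "(mono_on {a..b} lam \<and> (\<forall>s\<in>{a..b}. f s \<le> 0) \<longrightarrow>
            supermartingale a b \<Omega> (natural_filtration a \<Omega> X) M) \<and>
         (antimono_on {a..b} lam \<and> (\<forall>s\<in>{a..b}. f s \<ge> 0) \<longrightarrow>
            supermartingale a b \<Omega> (natural_filtration a \<Omega> X) M) \<and>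
         (antimono_on {a..b} lam \<and> (\<forall>s\<in>{a..b}. f s \<le> 0) \<longrightarrow>
            submartingale a b \<Omega> (natural_filtration a \<Omega> X) M)"
proof (intro conjI impI)
  assume *: "mono_on {a..b} lam \<and> (\<forall>s\<in>{a..b}. f s \<le> 0)"
  interpret monotone_yeh a b lam \<rho> \<Omega> X 1
    using assms(2-4) * by unfold_locales auto
  show "supermartingale a b \<Omega> (natural_filtration a \<Omega> X) M"
    using wiener_integral_super_submartingale(1)[OF assms(6)] * by auto
next
  assume *: "antimono_on {a..b} lam \<and> (\<forall>s\<in>{a..b}. f s \<ge> 0)"
  interpret monotone_yeh a b lam \<rho> \<Omega> X "-1"
    using assms(2-4) * by unfold_locales (auto simp: monotone_on_def)
  show "supermartingale a b \<Omega> (natural_filtration a \<Omega> X) M"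
    using wiener_integral_super_submartingale(1)[OF assms(6)] * by auto
next
  assume *: "antimono_on {a..b} lam \<and> (\<forall>s\<in>{a..b}. f s \<le> 0)"
  interpret monotone_yeh a b lam \<rho> \<Omega> X "-1"
    using assms(2-4) * by unfold_locales (auto simp: monotone_on_def)
  show "submartingale a b \<Omega> (natural_filtration a \<Omega> X) M"
    using wiener_integral_super_submartingale(2)[OF assms(6)] * by auto
qed

end
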